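(* Let $P_1$ and $P_2$ be two convex $M$-polyforms, and assume that $P_1$ DC-tiles $P_2$. Then there exists an injective group homomorphism (monomorphism) $G_{P_1}\rightarrowtail G_{P_2}$ from the sandpile group on $\Gamma(P_1)=\mathbb{Z}^2\cap P_1$ to the sandpile group on $\Gamma(P_2)=\mathbb{Z}^2\cap P_2$.
   Context: Let $M$ be the tiling of $\mathbb{R}^2$ by isosceles triangles with base length $1$ and height $\tfrac12$ such that each point of $(\mathbb{Z}+\tfrac12)^2$ is the apex of four triangles; equivalently, each closed unit square $[a,a+1]\times[b,b+1]$, $a,b\in\mathbb{Z}$, is cut by its two diagonals into four triangles. An $M$-polyform $P$ is a finite connected set of triangles of $M$, identified with the open set given by the interior of the union of its triangles; it is convex if this open set is convex. The automorphisms of $M$ are the maps $x\mapsto Ax+t$ with $A$ a $2\times 2$ signed permutation matrix and $t\in\mathbb{Z}^2$. For an $M$-polyform $P$, $P^{DC}$ denotes $P$ together with an assignment of a direction and a color to each of its sides (edges of its boundary) such that distinct sides receive distinct colors. $P_1$ DC-tiles $P_2$ if for some such assignment $P_1^{DC}$ there is a tiling of $P_2$ by finitely many images $g(P_1^{DC})$ under automorphisms $g$ of $M$ (images with pairwise disjoint interiors whose closures cover the closure of $P_2$, each image carrying the transported directions and colors) such that every common edge of two adjacent tiles has the same color and the same direction in both tiles. For a finite set $\Gamma\subset\mathbb{Z}^2$, consider the graph with vertex set $\Gamma\cup\{s\}$ obtained from the nearest-neighbor graph $\mathbb{Z}^2$ by identifying all vertices outside $\Gamma$ to a single sink $s$ (keeping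 multi-edges and deleting loops). The reduced Laplacian $\Delta_\Gamma:\mathbb{Z}^\Gamma\to\mathbb{Z}^\Gamma$ is $(\Delta_\Gamma f)(v)=\sum_{w\in\Gamma,\,w\sim v}f(w)-4f(v)$ (adjacency in $\mathbb{Z}^2$), and the sandpile group is $G_\Gamma=\mathbb{Z}^\Gamma/\Delta_\Gamma(\mathbb{Z}^\Gamma)$. For an $M$-polyform $P$ write $G_P=G_{\Gamma(P)}$ with $\Gamma(P)=\mathbb{Z}^2\cap P$. *)

theory Defs
  imports "HOL-Analysis.Analysis" "HOL-Algebra.Algebra"
begin

section \<open>The triangle tiling M\<close>

text \<open>A triangle of M is indexed by the lower-left corner (a,b) of its unit square
  and by which of the four sides of the square is its base.\<close>

datatype quarter = QBot | QRgt | QTop | QLft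

type_synonym trid = "int \<times> int \<times> quarter"
type_synonym pt = "real \<times> real"

definition tri_apex :: "trid \<Rightarrow> pt" where
  "tri_apex t = (case t of (a, b, _) \<Rightarrow> (of_int a + 1/2, of_int b + 1/2))"

definition tri_base :: "trid \<Rightarrow> pt \<times> pt" where
  "tri_base t = (case t of
     (a, b, QBot) \<Rightarrow> ((of_int a, of_int b), (of_int a + 1, of_int b))
   | (a, b, QRgt) \<Rightarrow> ((of_int a + 1, of_int b), (of_int a + 1, of_int b + 1))
   | (a, b, QTop) \<Rightarrow> ((of_int a + 1, of_int b + 1), (of_int a, of_int b + 1))
   | (a, b, QLft) \<Rightarrow> ((of_int a, of_int b + 1), (of_int a, of_int b)))"

definition tri_verts :: "trid \<Rightarrow> pt set" where
  "tri_verts t = {tri_apex t, fst (tri_base t), snd (tri_base t)}"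

text \<open>The closed triangle.\<close>
definition tri :: "trid \<Rightarrow> pt set" where
  "tri t = convex hull (tri_verts t)"

text \<open>Edges of a triangle, each represented by its two-element set of endpoints.\<close>
definition tri_edges :: "trid \<Rightarrow> pt set set" where
  "tri_edges t = {{tri_apex t, fst (tri_base t)}, {tri_apex t, snd (tri_base t)},
                  {fst (tri_base t), snd (tri_base t)}}"

text \<open>Two triangles are adjacent if they share an edge.\<close>
definition tri_adj :: "trid \<Rightarrow> trid \<Rightarrow> bool" where
  "tri_adj s t \<longleftrightarrow> s \<noteq> t \<and> tri_edges s \<inter> tri_edges t \<noteq> {}"

section \<open>M-polyforms\<close>

text \<open>The open set associated with a finite set of triangles.\<close>
definition region :: "trid set \<Rightarrow> pt set" where
  "region T = interior (\<Union> (tri ` T))"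

text \<open>An M-polyform: a finite, nonempty, (edge-)connected set of triangles of M.\<close>
definition polyform :: "trid set \<Rightarrow> bool" where
  "polyform T \<longleftrightarrow> finite T \<and> T \<noteq> {} \<and>
     (\<forall>s\<in>T. \<forall>t\<in>T. (s, t) \<in> {(x, y). x \<in> T \<and> y \<in> T \<and> tri_adj x y}\<^sup>*)"

definition convex_polyform :: "trid set \<Rightarrow> bool" where
  "convex_polyform T \<longleftrightarrow> polyform T \<and> convex (region T)"

text \<open>Sides of a polyform: edges of its triangles lying on the boundary of its open set.\<close>
definition sides :: "trid set \<Rightarrow> pt set set" where
  "sides T = {e. \<exists>t\<in>T. e \<in> tri_edges t \<and> convex hull e \<subseteq> frontier (region T)}"

section \<open>Automorphisms of M\<close>

definition aut_map :: "bool \<Rightarrow> int \<Rightarrow> int \<Rightarrow> int \<Rightarrow> int \<Rightarrow> pt \<Rightarrow> pt" where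
  "aut_map sw s1 s2 t1 t2 p =
     (let (u, v) = (if sw then (snd p, fst p) else p)
      in (of_int s1 * u + of_int t1, of_int s2 * v + of_int t2))"

definition Aut_M :: "(pt \<Rightarrow> pt) set" where
  "Aut_M = {aut_map sw s1 s2 t1 t2 | sw s1 s2 t1 t2. s1 \<in> {-1, 1} \<and> s2 \<in> {-1, 1}}"

section \<open>DC-tilings\<close>

text \<open>A direction/colour assignment on the sides of T: the direction of a side is given
  by its chosen starting endpoint, colours are natural numbers, distinct on distinct sides.\<close>
definition DC_assignment :: "trid set \<Rightarrow> (pt set \<Rightarrow> pt) \<Rightarrow> (pt set \<Rightarrow> nat) \<Rightarrow> bool" where
  "DC_assignment T dir col \<longleftrightarrow> (\<forall>e\<in>sides T. dir e \<in> e) \<and> inj_on col (sides T)"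

definition DC_tiles :: "trid set \<Rightarrow> trid set \<Rightarrow> bool" where
  "DC_tiles T1 T2 \<longleftrightarrow> (\<exists>dir col gs.
     DC_assignment T1 dir col \<and>
     set gs \<subseteq> Aut_M \<and>
     (\<forall>i<length gs. \<forall>j<length gs. i \<noteq> j \<longrightarrow>
        (gs ! i) ` region T1 \<inter> (gs ! j) ` region T1 = {}) \<and>
     (\<Union>i<length gs. closure ((gs ! i) ` region T1)) = closure (region T2) \<and>
     (\<forall>i<length gs. \<forall>j<length gs. \<forall>e\<in>sides T1. \<forall>e'\<in>sides T1.
        i \<noteq> j \<and> (gs ! i) ` e = (gs ! j) ` e' \<longrightarrow>
        col e = col e' \<and> (gs ! i) (dir e) = (gs ! j) (dir e')))"

section \<open>Sandpile groups\<close>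

text \<open>The additive group Z^Gamma, as functions supported on Gamma.\<close>
definition Zfun :: "(int \<times> int) set \<Rightarrow> ((int \<times> int) \<Rightarrow> int) monoid" where
  "Zfun \<Gamma> = \<lparr>carrier = {f. \<forall>v. v \<notin> \<Gamma> \<longrightarrow> f v = 0},
              mult = (\<lambda>f g v. f v + g v), one = (\<lambda>v. 0)\<rparr>"

definition nbrs :: "int \<times> int \<Rightarrow> (int \<times> int) list" where
  "nbrs v = (case v of (x, y) \<Rightarrow> [(x + 1, y), (x - 1, y), (x, y + 1), (x, y - 1)])"

text \<open>Reduced Laplacian.\<close>
definition red_lap :: "(int \<times> int) set \<Rightarrow> ((int \<times> int) \<Rightarrow> int) \<Rightarrow> (int \<times> int) \<Rightarrow> int" where
  "red_lap \<Gamma> f v = (if v \<in> \<Gamma>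
     then (\<Sum>w\<leftarrow>nbrs v. if w \<in> \<Gamma> then f w else 0) - 4 * f v else 0)"

definition sandpile_group :: "(int \<times> int) set \<Rightarrow> ((int \<times> int) \<Rightarrow> int) set monoid" where
  "sandpile_group \<Gamma> = Zfun \<Gamma> Mod (red_lap \<Gamma> ` carrier (Zfun \<Gamma>))"

definition GammaP :: "trid set \<Rightarrow> (int \<times> int) set" where
  "GammaP T = {(i, j). (of_int i, of_int j) \<in> region T}"

end

theory Submission
  imports Defs
begin

text \<open>A common edge of two adjacent tiles determines, by its colour and direction, a unique edge of
  the prototile and a pointwise identification with it, so adjacent tiles are mirror images in
  their common edge. Extending a function on the lattice points of \<open>P\<^sub>1\<close> to \<open>P\<^sub>2\<close> tile by tile,
  with the determinant of the automorphism as sign and \<open>0\<close> on tile boundaries, gives an injective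
  map \<open>E\<close> that is antisymmetric across every tile boundary. Hence the Laplacian of \<open>E f\<close> vanishes at
  the lattice points on tile boundaries, \<open>E\<close> commutes with the reduced Laplacians and induces a
  homomorphism of sandpile groups. It is injective: if \<open>E f = \<Delta> w\<close> with \<open>w\<close> integral and \<open>f = \<Delta> u\<close>
  with \<open>u\<close> rational, then \<open>w = E u\<close> since \<open>\<Delta>\<close> is injective, so \<open>u\<close> is integral.\<close>

section \<open>The reduced Laplacian and sandpile groups\<close>

text \<open>Fraction-free Gaussian elimination: each equation removed costs one unknown, so an
  unknown is left over.\<close>

lemma integer_dependence:
  fixes a :: "'i \<Rightarrow> 'j \<Rightarrow> int"
  assumes "finite I" "finite J" "card I < card J"
  shows "\<exists>x. (\<exists>j\<in>J. x j \<noteq> 0) \<and> (\<forall>i\<in>I. (\<Sum>j\<in>J. a i j * x j) = 0)"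
  using assms
proof (induction I arbitrary: J a rule: finite_induct)
  case empty
  then obtain k where "k \<in> J" by (metis card_gt_0_iff card.empty ex_in_conv)
  then show ?case by (intro exI[of _ "\<lambda>_. 1"]) auto
next
  case (insert i I)
  show ?case
  proof (cases "\<forall>j\<in>J. a i j = 0")
    case True
    have "card I < card J" using insert by simp
    from insert.IH[OF insert.prems(1) this, of a] True show ?thesis by auto
  next
    case False
    then obtain k where k: "k \<in> J" "a i k \<noteq> 0" by blast
    have card: "finite (J - {k})" "card I < card (J - {k})"
      using insert k by auto
    \<comment> \<open>Row \<open>i\<close> with pivot \<open>a i k\<close> eliminates unknown
      \<open>k\<close> from row \<open>l\<close>; cross-multiplying instead of dividing keeps the
      coefficients integral.\<close>
    obtain x where x: "\<exists>j\<in>J - {k}. x j \<noteq> 0"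
      "\<And>l. l \<in> I \<Longrightarrow> (\<Sum>j\<in>J - {k}. (a i k * a l j - a l k * a i j) * x j) = 0"
      using insert.IH[OF card, of "\<lambda>l j. a i k * a l j - a l k * a i j"] by blast
    \<comment> \<open>Scaling the other unknowns by the pivot lets \<open>y k\<close> solve row
      \<open>i\<close> without a division.\<close>
    define y where "y j = (if j = k then - (\<Sum>m\<in>J - {k}. a i m * x m) else a i k * x j)" for j
    \<comment> \<open>For \<open>l = i\<close> the coefficients on the right cancel, so this covers
      the pivot row too.\<close>
    have row: "(\<Sum>j\<in>J. a l j * y j)
        = (\<Sum>j\<in>J - {k}. (a i k * a l j - a l k * a i j) * x j)" for l
    proof -
      have "(\<Sum>j\<in>J. a l j * y j) = a l k * y k + (\<Sum>j\<in>J - {k}. a l j * y j)"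
        using k insert.prems by (simp add: sum.remove)
      also have "(\<Sum>j\<in>J - {k}. a l j * y j) = (\<Sum>j\<in>J - {k}. a i k * a l j * x j)"
        by (rule sum.cong) (auto simp: y_def)
      finally show ?thesis
        by (simp add: y_def algebra_simps sum_subtractf sum_distrib_left)
    qed
    have "(\<Sum>j\<in>J. a l j * y j) = 0" if "l \<in> insert i I" for l
      using that x(2) unfolding row by auto
    moreover from x(1) obtain j where "j \<in> J - {k}" "x j \<noteq> 0" by blast
    then have "\<exists>j\<in>J. y j \<noteq> 0" using k(2) by (intro bexI[of _ j]) (simp_all add: y_def)
    ultimately show ?thesis by blast
  qed
qed

section \<open>Linearity and injectivity of the reduced Laplacian\<close>

lemma Zfun_eq_0: "f \<in> carrier (Zfun \<Gamma>) \<Longrightarrow> v \<notin> \<Gamma> \<Longrightarrow> f v = 0"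
  unfolding Zfun_def by (cases v) auto

lemma red_lap_eq:
  "red_lap \<Gamma> f v = (if v \<in> \<Gamma> then (\<Sum>w\<leftarrow>nbrs v. f w) - 4 * f v else 0)"
  if "f \<in> carrier (Zfun \<Gamma>)"
proof -
  have "(if w \<in> \<Gamma> then f w else 0) = f w" for w
    using Zfun_eq_0[OF that, of w] by simp
  then show ?thesis unfolding red_lap_def by presburger
qed

lemma red_lap_closed: "red_lap \<Gamma> f \<in> carrier (Zfun \<Gamma>)"
  by (simp add: Zfun_def red_lap_def)

lemma red_lap_add: "red_lap \<Gamma> (\<lambda>v. f v + g v) = (\<lambda>v. red_lap \<Gamma> f v + red_lap \<Gamma> g v)"
  by (auto simp: red_lap_def nbrs_def fun_eq_iff algebra_simps split: prod.splits)

lemma red_lap_scale: "red_lap \<Gamma> (\<lambda>v. k * f v) = (\<lambda>v. k * red_lap \<Gamma> f v)"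
  by (auto simp: red_lap_def nbrs_def fun_eq_iff algebra_simps split: prod.splits)

lemma red_lap_uminus: "red_lap \<Gamma> (\<lambda>v. - f v) = (\<lambda>v. - red_lap \<Gamma> f v)"
  using red_lap_scale[of \<Gamma> "-1" f] by simp

lemma red_lap_zero: "red_lap \<Gamma> (\<lambda>v. 0) = (\<lambda>v. 0)"
  using red_lap_scale[of \<Gamma> "0" "\<lambda>v. 0"] by simp

lemma red_lap_sum:
  "finite J \<Longrightarrow> red_lap \<Gamma> (\<lambda>v. \<Sum>j\<in>J. F j v) = (\<lambda>v. \<Sum>j\<in>J. red_lap \<Gamma> (F j) v)"
  by (induction J rule: finite_induct) (simp_all add: red_lap_zero red_lap_add)

text \<open>Maximum principle, applied at a rightmost maximum, whose right neighbour is strictly smaller.\<close>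

lemma red_lap_zero_imp_nonpos:
  assumes fin: "finite \<Gamma>" and f: "f \<in> carrier (Zfun \<Gamma>)" and lap: "red_lap \<Gamma> f = (\<lambda>v. 0)"
  shows "f v \<le> 0"
proof (rule ccontr)
  assume "\<not> f v \<le> 0"
  then have pos: "f v > 0" by simp
  have supp: "w \<in> \<Gamma>" if "f w > 0" for w using Zfun_eq_0[OF f, of w] that by (cases "w \<in> \<Gamma>") simp_all
  define M where "M = Max (f ` \<Gamma>)"
  have "v \<in> \<Gamma>" using pos by (rule supp)
  then have "f v \<le> M" unfolding M_def using fin by (intro Max_ge) auto
  then have "M > 0" using pos by simp
  have le: "f w \<le> M" for w
  proof (cases "w \<in> \<Gamma>")
    case True then show ?thesis using fin by (auto simp: M_def)
  next
    case False then show ?thesis using Zfun_eq_0[OF f False] \<open>M > 0\<close> by simp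
  qed
  define A where "A = {w \<in> \<Gamma>. f w = M}"
  have "M \<in> f ` \<Gamma>" unfolding M_def using fin \<open>v \<in> \<Gamma>\<close> by (intro Max_in) auto
  then have "A \<noteq> {}" "finite A" using fin by (auto simp: A_def)
  define x where "x = Max (fst ` A)"
  have "x \<in> fst ` A" unfolding x_def using \<open>A \<noteq> {}\<close> \<open>finite A\<close> by (intro Max_in) auto
  then obtain p where p: "p \<in> A" "x = fst p" by (rule imageE)
  define y where "y = snd p"
  have xy: "(x, y) \<in> A" using p by (simp add: y_def)
  have "(x + 1, y) \<notin> A"
  proof
    assume "(x + 1, y) \<in> A"
    then have "x + 1 \<in> fst ` A" by (rule image_eqI[rotated]) simp
    then have "x + 1 \<le> x" unfolding x_def using \<open>finite A\<close> by (intro Max_ge) auto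
    then show False by simp
  qed
  \<comment> \<open>The right neighbour may lie outside \<open>\<Gamma>\<close>; its value is then
    0, hence not \<open>M\<close>.\<close>
  then have "f (x + 1, y) \<noteq> M" using supp[of "(x + 1, y)"] \<open>M > 0\<close> by (auto simp: A_def)
  then have "f (x + 1, y) < M" using le[of "(x + 1, y)"] by simp
  moreover have "f (x + 1, y) + f (x - 1, y) + f (x, y + 1) + f (x, y - 1) = 4 * M"
    using fun_cong[OF lap, of "(x, y)"] xy unfolding red_lap_eq[OF f]
    by (simp add: A_def nbrs_def)
  ultimately show False
    using le[of "(x - 1, y)"] le[of "(x, y + 1)"] le[of "(x, y - 1)"] by linarith
qed

text \<open>Linearity lets the maximum principle act on the difference in both orders.\<close>

lemma red_lap_inj:
  assumes fin: "finite \<Gamma>" and f: "f \<in> carrier (Zfun \<Gamma>)" and g: "g \<in> carrier (Zfun \<Gamma>)"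
    and eq: "red_lap \<Gamma> f = red_lap \<Gamma> g"
  shows "f = g"
proof
  fix v
  have lap: "red_lap \<Gamma> (\<lambda>v. f v + - g v) = (\<lambda>v. 0)" "red_lap \<Gamma> (\<lambda>v. g v + - f v) = (\<lambda>v. 0)"
    unfolding red_lap_add red_lap_uminus by (simp_all add: eq)
  have "f v + - g v \<le> 0" "g v + - f v \<le> 0"
    using red_lap_zero_imp_nonpos[OF fin _ lap(1), of v]
      red_lap_zero_imp_nonpos[OF fin _ lap(2), of v] f g by (auto simp: Zfun_def)
  then show "f v = g v" by simp
qed

text \<open>Rational solvability with the denominator \<open>k\<close> cleared: \<open>f\<close> and
  the Laplacians of the point masses are \<open>card \<Gamma> + 1\<close> vectors in rank
  \<open>card \<Gamma>\<close>, hence dependent, and injectivity of the Laplacian keeps the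
  coefficient of \<open>f\<close> from vanishing.\<close>

lemma red_lap_solvable_multiple:
  assumes fin: "finite \<Gamma>" and f: "f \<in> carrier (Zfun \<Gamma>)"
  obtains k u where "k \<noteq> 0" "u \<in> carrier (Zfun \<Gamma>)" "red_lap \<Gamma> u = (\<lambda>v. k * f v)"
proof -
  \<comment> \<open>\<open>None\<close> stands for \<open>f\<close> itself, \<open>Some w\<close>
    for the column of the Laplacian at \<open>w\<close>.\<close>
  define F where "F j = (case j of None \<Rightarrow> f | Some w \<Rightarrow> red_lap \<Gamma> (\<lambda>v. if v = w then 1 else 0))" for j
  define J where "J = insert None (Some ` \<Gamma>)"
  have "finite J" "card \<Gamma> < card J"
    using fin by (auto simp: J_def card_image)
  from integer_dependence[OF fin this, of "\<lambda>v j. F j v"] obtain x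
    where x: "\<exists>j\<in>J. x j \<noteq> 0" "\<And>v. v \<in> \<Gamma> \<Longrightarrow> (\<Sum>j\<in>J. F j v * x j) = 0" by blast
  define u where "u v = (\<Sum>w\<in>\<Gamma>. x (Some w) * (if v = w then 1 else 0))" for v
  have u_eq: "u v = (if v \<in> \<Gamma> then x (Some v) else 0)" for v
  proof -
    have "u v = (\<Sum>w\<in>\<Gamma>. if w = v then x (Some w) else 0)"
      unfolding u_def by (rule sum.cong) auto
    then show ?thesis using fin by simp
  qed
  have u: "u \<in> carrier (Zfun \<Gamma>)" by (simp add: Zfun_def u_eq)
  have lap_u: "red_lap \<Gamma> u v = - x None * f v" for v
  proof (cases "v \<in> \<Gamma>")
    case True
    have "red_lap \<Gamma> u v = (\<Sum>w\<in>\<Gamma>. x (Some w) * F (Some w) v)"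
      using fin by (simp add: u_def[abs_def] red_lap_sum red_lap_scale F_def)
    moreover have "(\<Sum>j\<in>J. F j v * x j) = f v * x None + (\<Sum>w\<in>\<Gamma>. F (Some w) v * x (Some w))"
      using fin by (simp add: J_def sum.reindex F_def)
    ultimately show ?thesis using x(2)[OF True] by (simp add: algebra_simps)
  next
    case False
    then show ?thesis using Zfun_eq_0[OF f False] by (simp add: red_lap_def)
  qed
  \<comment> \<open>Otherwise \<open>u\<close> lies in the kernel of the Laplacian and the
    dependence is trivial.\<close>
  have "x None \<noteq> 0"
  proof
    assume 0: "x None = 0"
    then have "red_lap \<Gamma> u = red_lap \<Gamma> (\<lambda>v. 0)"
      unfolding red_lap_zero by (intro ext) (simp add: lap_u)
    then have "u = (\<lambda>v. 0)" by (rule red_lap_inj[OF fin u, rotated]) (simp add: Zfun_def)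
    then have "x (Some v) = 0" if "v \<in> \<Gamma>" for v using u_eq[of v] that by simp
    then show False using x(1) 0 by (auto simp: J_def)
  qed
  then have "- x None \<noteq> 0" by simp
  moreover have "red_lap \<Gamma> u = (\<lambda>v. - x None * f v)" by (intro ext lap_u)
  ultimately show ?thesis using u that by blast
qed

section \<open>The group structure and a criterion for monomorphisms\<close>

lemma Zfun_comm_group: "comm_group (Zfun \<Gamma>)"
proof (rule comm_groupI)
  fix f assume "f \<in> carrier (Zfun \<Gamma>)"
  then show "\<exists>g\<in>carrier (Zfun \<Gamma>). g \<otimes>\<^bsub>Zfun \<Gamma>\<^esub> f = \<one>\<^bsub>Zfun \<Gamma>\<^esub>"
    by (intro bexI[of _ "\<lambda>v. - f v"]) (auto simp: Zfun_def)
qed (auto simp: Zfun_def)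

lemma Zfun_inv: "f \<in> carrier (Zfun \<Gamma>) \<Longrightarrow> inv\<^bsub>Zfun \<Gamma>\<^esub> f = (\<lambda>v. - f v)"
  using comm_group.axioms(2)[OF Zfun_comm_group]
  by (intro group.inv_equality) (auto simp: Zfun_def)

lemma red_lap_image_normal: "red_lap \<Gamma> ` carrier (Zfun \<Gamma>) \<lhd> Zfun \<Gamma>"
proof -
  interpret comm_group "Zfun \<Gamma>" by (rule Zfun_comm_group)
  have "subgroup (red_lap \<Gamma> ` carrier (Zfun \<Gamma>)) (Zfun \<Gamma>)"
  proof (rule subgroupI)
    show "red_lap \<Gamma> ` carrier (Zfun \<Gamma>) \<subseteq> carrier (Zfun \<Gamma>)" using red_lap_closed by blast
    show "red_lap \<Gamma> ` carrier (Zfun \<Gamma>) \<noteq> {}" using one_closed by blast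
  next
    fix f assume "f \<in> red_lap \<Gamma> ` carrier (Zfun \<Gamma>)"
    then obtain u where u: "f = red_lap \<Gamma> u" "u \<in> carrier (Zfun \<Gamma>)" by auto
    then have "inv\<^bsub>Zfun \<Gamma>\<^esub> f = red_lap \<Gamma> (\<lambda>v. - u v)"
      by (simp add: Zfun_inv red_lap_closed red_lap_uminus)
    then show "inv\<^bsub>Zfun \<Gamma>\<^esub> f \<in> red_lap \<Gamma> ` carrier (Zfun \<Gamma>)" using u by (auto simp: Zfun_def)
  next
    fix f g assume "f \<in> red_lap \<Gamma> ` carrier (Zfun \<Gamma>)" "g \<in> red_lap \<Gamma> ` carrier (Zfun \<Gamma>)"
    then obtain u w where uw: "f = red_lap \<Gamma> u" "u \<in> carrier (Zfun \<Gamma>)"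
      "g = red_lap \<Gamma> w" "w \<in> carrier (Zfun \<Gamma>)" by auto
    then have "f \<otimes>\<^bsub>Zfun \<Gamma>\<^esub> g = red_lap \<Gamma> (u \<otimes>\<^bsub>Zfun \<Gamma>\<^esub> w)"
      by (simp add: Zfun_def red_lap_add)
    then show "f \<otimes>\<^bsub>Zfun \<Gamma>\<^esub> g \<in> red_lap \<Gamma> ` carrier (Zfun \<Gamma>)" using uw m_closed by blast
  qed
  then show ?thesis by (simp add: subgroup_imp_normal)
qed

text \<open>The hypothesis \<open>div\<close> makes a rational preimage of \<open>f\<close> under the Laplacian integral as
  soon as its image under \<open>E\<close> is integral.\<close>

lemma sandpile_monomorphism:
  fixes E :: "((int \<times> int) \<Rightarrow> int) \<Rightarrow> (int \<times> int) \<Rightarrow> int"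
  assumes fin: "finite \<Gamma>" "finite \<Gamma>'"
    and closed: "\<And>f. f \<in> carrier (Zfun \<Gamma>) \<Longrightarrow> E f \<in> carrier (Zfun \<Gamma>')"
    and add: "\<And>f g. E (\<lambda>v. f v + g v) = (\<lambda>v. E f v + E g v)"
    and scale: "\<And>k f. E (\<lambda>v. k * f v) = (\<lambda>v. k * E f v)"
    and div: "\<And>k f. f \<in> carrier (Zfun \<Gamma>) \<Longrightarrow> (\<forall>v. k dvd E f v) \<Longrightarrow> (\<forall>v. k dvd f v)"
    and lap: "\<And>f. f \<in> carrier (Zfun \<Gamma>) \<Longrightarrow> red_lap \<Gamma>' (E f) = E (red_lap \<Gamma> f)"
  shows "\<exists>h. h \<in> hom (sandpile_group \<Gamma>) (sandpile_group \<Gamma>') \<and>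
             inj_on h (carrier (sandpile_group \<Gamma>))"
proof -
  let ?H = "red_lap \<Gamma> ` carrier (Zfun \<Gamma>)" and ?H' = "red_lap \<Gamma>' ` carrier (Zfun \<Gamma>')"
  interpret H': normal ?H' "Zfun \<Gamma>'" by (rule red_lap_image_normal)
  interpret Z: comm_group "Zfun \<Gamma>" by (rule Zfun_comm_group)
  define \<theta> where "\<theta> f = ?H' #>\<^bsub>Zfun \<Gamma>'\<^esub> E f" for f
  have "group (sandpile_group \<Gamma>')"
    unfolding sandpile_group_def by (rule H'.factorgroup_is_group)
  moreover have "\<theta> \<in> hom (Zfun \<Gamma>) (sandpile_group \<Gamma>')"
  proof -
    have "E \<in> hom (Zfun \<Gamma>) (Zfun \<Gamma>')"
      using closed add by (auto simp: hom_def Zfun_def)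
    from hom_compose[OF this H'.r_coset_hom_Mod] show ?thesis
      by (simp add: \<theta>_def[abs_def] sandpile_group_def o_def)
  qed
  ultimately interpret \<theta>: group_hom "Zfun \<Gamma>" "sandpile_group \<Gamma>'" \<theta>
    by (simp add: group_hom_def group_hom_axioms_def Z.is_group)
  have in_H: "f \<in> ?H" if f: "f \<in> carrier (Zfun \<Gamma>)" and "E f \<in> ?H'" for f
  proof -
    obtain w where w: "w \<in> carrier (Zfun \<Gamma>')" "E f = red_lap \<Gamma>' w"
      using \<open>E f \<in> ?H'\<close> by blast
    obtain k u where k: "k \<noteq> 0" and u: "u \<in> carrier (Zfun \<Gamma>)" "red_lap \<Gamma> u = (\<lambda>v. k * f v)"
      by (rule red_lap_solvable_multiple[OF fin(1) f])
    \<comment> \<open>Both sides equal \<open>k\<close> times \<open>E f\<close>, the left one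
      because \<open>E\<close> intertwines the Laplacians.\<close>
    have "red_lap \<Gamma>' (E u) = red_lap \<Gamma>' (\<lambda>v. k * w v)"
      by (simp only: lap u scale w(2) red_lap_scale)
    then have "E u = (\<lambda>v. k * w v)"
      using w(1) by (intro red_lap_inj[OF fin(2) closed[OF u(1)]]) (simp_all add: Zfun_def)
    then have "\<forall>v. k dvd E u v" by (simp only: dvd_triv_left simp_thms)
    then have dvd: "\<forall>v. k dvd u v" by (rule div[OF u(1)])
    define u' where "u' v = u v div k" for v
    have u_eq: "(\<lambda>v. k * u' v) = u"
    proof
      fix v
      show "k * u' v = u v" unfolding u'_def using dvd by (intro dvd_mult_div_cancel) (rule spec)
    qed
    have "(\<lambda>v. k * red_lap \<Gamma> u' v) = (\<lambda>v. k * f v)"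
      unfolding red_lap_scale[symmetric] u_eq by (rule u(2))
    from fun_cong[OF this] have "red_lap \<Gamma> u' v = f v" for v using k by simp
    then have "red_lap \<Gamma> u' = f" by blast
    moreover have "u' \<in> carrier (Zfun \<Gamma>)" using u(1) by (simp add: Zfun_def u'_def)
    ultimately show ?thesis by blast
  qed
  \<comment> \<open>With this kernel, the first isomorphism theorem embeds the quotient.\<close>
  have "kernel (Zfun \<Gamma>) (sandpile_group \<Gamma>') \<theta> = ?H"
  proof -
    have "\<theta> f = \<one>\<^bsub>sandpile_group \<Gamma>'\<^esub> \<longleftrightarrow> f \<in> ?H" if f: "f \<in> carrier (Zfun \<Gamma>)" for f
    proof -
      have "\<theta> f = \<one>\<^bsub>sandpile_group \<Gamma>'\<^esub> \<longleftrightarrow> E f \<in> ?H'"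
        unfolding \<theta>_def sandpile_group_def one_FactGroup
        using H'.coset_join1[OF _ closed[OF f] H'.subgroup_axioms]
          H'.coset_join2[OF closed[OF f] H'.subgroup_axioms] by blast
      also have "\<dots> \<longleftrightarrow> f \<in> ?H"
      proof
        assume "f \<in> ?H"
        then obtain u where u: "u \<in> carrier (Zfun \<Gamma>)" "f = red_lap \<Gamma> u" by blast
        then have "E f = red_lap \<Gamma>' (E u)" by (simp only: lap)
        with closed[OF u(1)] show "E f \<in> ?H'" by blast
      qed (rule in_H[OF f])
      finally show ?thesis .
    qed
    then show ?thesis using red_lap_closed unfolding kernel_def by blast
  qed
  then have "sandpile_group \<Gamma> = Zfun \<Gamma> Mod kernel (Zfun \<Gamma>) (sandpile_group \<Gamma>') \<theta>"
    by (simp add: sandpile_group_def)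
  then show ?thesis
    using \<theta>.FactGroup_hom \<theta>.FactGroup_inj_on by metis
qed

section \<open>Sectors and triangles\<close>

definition lattice_pt :: "int \<times> int \<Rightarrow> pt" where
  "lattice_pt v = (of_int (fst v), of_int (snd v))"

text \<open>The edges at a lattice point \<open>v\<close> are numbered counterclockwise modulo 8 in steps of 45 degrees:
  \<open>dvec d\<close> is the edge vector (a unit vector for even \<open>d\<close>, half a diagonal for odd \<open>d\<close>) and \<open>sector v d\<close>
  is the triangle at \<open>v\<close> between the edges \<open>d\<close> and \<open>d + 1\<close>. The \<open>ivec\<close> of an odd number is junk.\<close>

definition wave :: "int \<Rightarrow> real" where
  "wave d = \<bar>4 - of_int (d mod 8)\<bar> / 2 - 1"

definition dvec :: "int \<Rightarrow> pt" where
  "dvec d = (wave d, wave (d - 2))"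

definition ivec :: "int \<Rightarrow> int \<times> int" where
  "ivec d = (if d mod 8 = 0 then (1, 0) else if d mod 8 = 2 then (0, 1)
     else if d mod 8 = 4 then (-1, 0) else (0, -1))"

definition sector :: "int \<times> int \<Rightarrow> int \<Rightarrow> trid" where
  "sector v d = (case v of (x, y) \<Rightarrow>
     if d mod 8 = 0 then (x, y, QBot) else if d mod 8 = 1 then (x, y, QLft)
     else if d mod 8 = 2 then (x - 1, y, QRgt) else if d mod 8 = 3 then (x - 1, y, QBot)
     else if d mod 8 = 4 then (x - 1, y - 1, QTop) else if d mod 8 = 5 then (x - 1, y - 1, QRgt)
     else if d mod 8 = 6 then (x, y - 1, QLft) else (x, y - 1, QTop))"

text \<open>On the symbolic residues \<open>8 * q + r\<close> functions of \<open>d mod 8\<close>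
  evaluate, so statements about directions become eight computations.\<close>

lemma mod8_cases:
  fixes d :: int
  obtains q where "d = 8 * q" | q where "d = 8 * q + 1" | q where "d = 8 * q + 2"
  | q where "d = 8 * q + 3" | q where "d = 8 * q + 4" | q where "d = 8 * q + 5"
  | q where "d = 8 * q + 6" | q where "d = 8 * q + 7"
proof -
  have "d = 8 * (d div 8) + d mod 8" by simp
  moreover have "d mod 8 = 0 \<or> d mod 8 = 1 \<or> d mod 8 = 2 \<or> d mod 8 = 3 \<or> d mod 8 = 4 \<or>
    d mod 8 = 5 \<or> d mod 8 = 6 \<or> d mod 8 = 7" by presburger
  ultimately show ?thesis using that by (metis add.right_neutral)
qed

text \<open>\<open>wave\<close> is a piecewise linear cosine of period 8, and its shift by 2 the
  corresponding sine; here begin its symmetry laws.\<close>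

lemma wave_minus: "wave (- d) = wave d"
  by (simp add: wave_def zmod_zminus1_eq_if abs_minus_commute)

lemma wave_add_4: "wave (d + 4) = - wave d"
  by (cases d rule: mod8_cases; simp add: wave_def)

lemma wave_diff: "wave (d - 2) = - wave (d + 2)" "wave (d - 4) = - wave d"
  using wave_add_4[of "d - 2"] wave_add_4[of "d - 4"] by (simp_all add: algebra_simps)

lemma sector_cong: "d mod 8 = d' mod 8 \<Longrightarrow> sector v d = sector v d'"
  by (simp only: sector_def)

text \<open>The first coordinate fixes the direction up to reflection in the horizontal axis, and
  the second decides between the two.\<close>

lemma dvec_inj:
  assumes "dvec d = dvec d'"
  shows "d mod 8 = d' mod 8"
proof -
  have wave: "\<bar>4 - a mod 8\<bar> = \<bar>4 - b mod 8\<bar>" if "wave a = wave b" for a b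
  proof -
    have "real_of_int \<bar>4 - a mod 8\<bar> = real_of_int \<bar>4 - b mod 8\<bar>"
      using that by (simp add: wave_def)
    then show ?thesis by (simp only: of_int_eq_iff)
  qed
  have eq: "\<bar>4 - d mod 8\<bar> = \<bar>4 - d' mod 8\<bar>" "\<bar>4 - (d + 2) mod 8\<bar> = \<bar>4 - (d' + 2) mod 8\<bar>"
    by (rule wave; use assms in \<open>simp add: dvec_def wave_diff\<close>)+
  have shift: "(e + 2) mod 8 = (if e mod 8 < 6 then e mod 8 + 2 else e mod 8 - 6)" for e :: int
    by (cases e rule: mod8_cases) simp_all
  have "r = r'" if "0 \<le> r" "r < 8" "0 \<le> r'" "r' < 8" "\<bar>4 - r\<bar> = \<bar>4 - r'\<bar>"
    "\<bar>4 - (if r < 6 then r + 2 else r - 6)\<bar> = \<bar>4 - (if r' < 6 then r' + 2 else r' - 6)\<bar>"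
    for r r' :: int
    using that by (auto simp: abs_if split: if_splits)
  from this[OF _ _ _ _ eq(1) eq(2)[unfolded shift]] show ?thesis by simp
qed

lemma dvec_even: "even d \<Longrightarrow> dvec d = lattice_pt (ivec d)"
  unfolding dvec_def wave_diff
  by (cases d rule: mod8_cases; simp add: wave_def ivec_def lattice_pt_def)

lemma lattice_pt_add: "lattice_pt (v + w) = lattice_pt v + lattice_pt w"
  by (simp add: lattice_pt_def)

lemma lattice_pt_inj: "lattice_pt v = lattice_pt w \<Longrightarrow> v = w"
  by (simp add: lattice_pt_def prod_eq_iff)

text \<open>From its far end the unit edge \<open>d\<close> is seen as edge \<open>d + 4\<close>;
  the triangle on its left comes just before that edge there, the one on its right just
  after.\<close>

lemma sector_shift: "even d \<Longrightarrow> sector (v + ivec d) (d + 3) = sector v d"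
  "even d \<Longrightarrow> sector (v + ivec d) (d + 4) = sector v (d - 1)"
proof -
  \<comment> \<open>A nonnegative offset lets \<open>mod 8\<close> evaluate after the case
    split.\<close>
  have "sector v (d - 1) = sector v (d + 7)" by (rule sector_cong) (simp add: mod_eq_dvd_iff)
  then show "even d \<Longrightarrow> sector (v + ivec d) (d + 4) = sector v (d - 1)"
    by (cases d rule: mod8_cases; cases v; simp add: sector_def ivec_def)
  show "even d \<Longrightarrow> sector (v + ivec d) (d + 3) = sector v d"
    by (cases d rule: mod8_cases; cases v; simp add: sector_def ivec_def)
qed

lemma sector_inj: "sector v d = sector w d \<Longrightarrow> v = w"
  by (cases v; cases w) (auto simp: sector_def split: if_splits)

text \<open>A triangle is a sector at either endpoint of its base; each case names one of
  them.\<close>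

lemma sector_surj: "\<exists>v d. t = sector v d"
proof (cases t)
  case (fields a b q)
  show ?thesis unfolding fields
  proof (cases q)
    case QBot then show "\<exists>v d. (a, b, q) = sector v d"
      by (intro exI[of _ "(a, b)"] exI[of _ 0]) (simp add: sector_def)
  next
    case QLft then show "\<exists>v d. (a, b, q) = sector v d"
      by (intro exI[of _ "(a, b)"] exI[of _ 1]) (simp add: sector_def)
  next
    case QRgt then show "\<exists>v d. (a, b, q) = sector v d"
      by (intro exI[of _ "(a + 1, b)"] exI[of _ 2]) (simp add: sector_def)
  next
    case QTop then show "\<exists>v d. (a, b, q) = sector v d"
      by (intro exI[of _ "(a + 1, b + 1)"] exI[of _ 4]) (simp add: sector_def)
  qed
qed

lemma tri_edges_sector:
  "tri_edges (sector v d) = {{lattice_pt v, lattice_pt v + dvec d},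
     {lattice_pt v, lattice_pt v + dvec (d + 1)},
     {lattice_pt v + dvec d, lattice_pt v + dvec (d + 1)}}"
  unfolding dvec_def wave_diff
  by (cases d rule: mod8_cases; cases v;
      simp add: tri_edges_def tri_apex_def tri_base_def sector_def lattice_pt_def wave_def
        insert_commute algebra_simps)

lemma tri_verts_sector:
  "tri_verts (sector v d) = {lattice_pt v, lattice_pt v + dvec d, lattice_pt v + dvec (d + 1)}"
proof -
  have "tri_verts t = \<Union> (tri_edges t)" for t
    by (auto simp: tri_verts_def tri_edges_def)
  then show ?thesis by (auto simp: tri_edges_sector)
qed


section \<open>Triangles as intersections of half-planes\<close>

definition closed_tri :: "trid \<Rightarrow> pt set" where
  "closed_tri t = (case t of (a, b, q) \<Rightarrow> {(x, y). (case q of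
     QBot \<Rightarrow> of_int b \<le> y \<and> y - b \<le> x - a \<and> (x - a) + (y - b) \<le> 1
   | QRgt \<Rightarrow> x \<le> a + 1 \<and> y - b \<le> x - a \<and> 1 \<le> (x - a) + (y - b)
   | QTop \<Rightarrow> y \<le> b + 1 \<and> x - a \<le> y - b \<and> 1 \<le> (x - a) + (y - b)
   | QLft \<Rightarrow> of_int a \<le> x \<and> x - a \<le> y - b \<and> (x - a) + (y - b) \<le> 1)})"

text \<open>Serves as the interior of the triangle: it is open, dense in \<open>tri t\<close> and
  disjoint from every other triangle.\<close>

definition open_tri :: "trid \<Rightarrow> pt set" where
  "open_tri t = (case t of (a, b, q) \<Rightarrow> {(x, y). (case q of
     QBot \<Rightarrow> of_int b < y \<and> y - b < x - a \<and> (x - a) + (y - b) < 1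
   | QRgt \<Rightarrow> x < a + 1 \<and> y - b < x - a \<and> 1 < (x - a) + (y - b)
   | QTop \<Rightarrow> y < b + 1 \<and> x - a < y - b \<and> 1 < (x - a) + (y - b)
   | QLft \<Rightarrow> of_int a < x \<and> x - a < y - b \<and> (x - a) + (y - b) < 1)})"

lemma tri_eq_closed_tri: "tri t = closed_tri t"
proof -
  have hull: "(x, y) \<in> convex hull {(x0, y0), (x1, y1), (x2, y2)} \<longleftrightarrow>
    (\<exists>u v. 0 \<le> u \<and> 0 \<le> v \<and> u + v \<le> 1 \<and> x = x0 + u * (x1 - x0) + v * (x2 - x0)
       \<and> y = y0 + u * (y1 - y0) + v * (y2 - y0))" for x y x0 y0 x1 y1 x2 y2 :: real
    unfolding convex_hull_3_alt by auto
  obtain a b q where t: "t = (a, b, q)" by (cases t)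
  have "(x, y) \<in> tri t \<longleftrightarrow> (x, y) \<in> closed_tri t" for x y
  proof (cases q)
    case QBot
    have eq: "(x, y) \<in> tri t \<longleftrightarrow> (\<exists>u v. 0 \<le> u \<and> 0 \<le> v \<and> u + v \<le> 1 \<and>
      x = a + 1/2 - u/2 + v/2 \<and> y = b + 1/2 - u/2 - v/2)"
      unfolding tri_def tri_verts_def by (simp add: t QBot tri_apex_def tri_base_def hull algebra_simps)
    show ?thesis
    proof
      assume "(x, y) \<in> tri t" then show "(x, y) \<in> closed_tri t"
        unfolding eq by (auto simp: closed_tri_def t QBot)
    next
      assume "(x, y) \<in> closed_tri t" then show "(x, y) \<in> tri t" unfolding eq
        \<comment> \<open>The barycentric weights of the two base endpoints, solved from
          \<open>eq\<close>; the other three cases are alike.\<close>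
        by (intro exI[of _ "1 - (x - a) - (y - b)"] exI[of _ "(x - a) - (y - b)"])
          (auto simp: closed_tri_def t QBot field_simps)
    qed
  next
    case QRgt
    have eq: "(x, y) \<in> tri t \<longleftrightarrow> (\<exists>u v. 0 \<le> u \<and> 0 \<le> v \<and> u + v \<le> 1 \<and>
      x = a + 1/2 + u/2 + v/2 \<and> y = b + 1/2 - u/2 + v/2)"
      unfolding tri_def tri_verts_def by (simp add: t QRgt tri_apex_def tri_base_def hull algebra_simps)
    show ?thesis
    proof
      assume "(x, y) \<in> tri t" then show "(x, y) \<in> closed_tri t"
        unfolding eq by (auto simp: closed_tri_def t QRgt)
    next
      assume "(x, y) \<in> closed_tri t" then show "(x, y) \<in> tri t" unfolding eq
        by (intro exI[of _ "(x - a) - (y - b)"] exI[of _ "(x - a) + (y - b) - 1"])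
          (auto simp: closed_tri_def t QRgt field_simps)
    qed
  next
    case QTop
    have eq: "(x, y) \<in> tri t \<longleftrightarrow> (\<exists>u v. 0 \<le> u \<and> 0 \<le> v \<and> u + v \<le> 1 \<and>
      x = a + 1/2 + u/2 - v/2 \<and> y = b + 1/2 + u/2 + v/2)"
      unfolding tri_def tri_verts_def by (simp add: t QTop tri_apex_def tri_base_def hull algebra_simps)
    show ?thesis
    proof
      assume "(x, y) \<in> tri t" then show "(x, y) \<in> closed_tri t"
        unfolding eq by (auto simp: closed_tri_def t QTop)
    next
      assume "(x, y) \<in> closed_tri t" then show "(x, y) \<in> tri t" unfolding eq
        by (intro exI[of _ "(x - a) + (y - b) - 1"] exI[of _ "(y - b) - (x - a)"])
          (auto simp: closed_tri_def t QTop field_simps)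
    qed
  next
    case QLft
    have eq: "(x, y) \<in> tri t \<longleftrightarrow> (\<exists>u v. 0 \<le> u \<and> 0 \<le> v \<and> u + v \<le> 1 \<and>
      x = a + 1/2 - u/2 - v/2 \<and> y = b + 1/2 + u/2 - v/2)"
      unfolding tri_def tri_verts_def by (simp add: t QLft tri_apex_def tri_base_def hull algebra_simps)
    show ?thesis
    proof
      assume "(x, y) \<in> tri t" then show "(x, y) \<in> closed_tri t"
        unfolding eq by (auto simp: closed_tri_def t QLft)
    next
      assume "(x, y) \<in> closed_tri t" then show "(x, y) \<in> tri t" unfolding eq
        by (intro exI[of _ "(y - b) - (x - a)"] exI[of _ "1 - (x - a) - (y - b)"])
          (auto simp: closed_tri_def t QLft field_simps)
    qed
  qed
  then show ?thesis by auto
qed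

lemma open_open_tri: "open (open_tri t)"
proof -
  obtain a b q where t: "t = (a, b, q)" by (cases t)
  have *: "open {p :: pt. f p < g p \<and> h p < k p \<and> l p < m p}"
    if "continuous_on UNIV f" "continuous_on UNIV g" "continuous_on UNIV h"
      "continuous_on UNIV k" "continuous_on UNIV l" "continuous_on UNIV m"
    for f g h k l m :: "pt \<Rightarrow> real"
    using that by (intro open_Collect_conj open_Collect_less)
  show ?thesis
    by (cases q; simp add: open_tri_def t case_prod_beta';
        (rule * ; intro continuous_intros))
qed

lemma open_tri_subset: "open_tri t \<subseteq> tri t"
  unfolding tri_eq_closed_tri
  by (cases t) (auto simp: open_tri_def closed_tri_def split: quarter.splits)

lemma open_tri_nonempty: "open_tri t \<noteq> {}"
proof -
  obtain a b q where t: "t = (a, b, q)" by (cases t)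
  have "(a + 1/2, b + 1/4) \<in> open_tri (a, b, QBot)" "(a + 3/4, b + 1/2) \<in> open_tri (a, b, QRgt)"
    "(a + 1/2, b + 3/4) \<in> open_tri (a, b, QTop)" "(a + 1/4, b + 1/2) \<in> open_tri (a, b, QLft)"
    by (simp_all add: open_tri_def)
  then show ?thesis by (cases q) (auto simp: t)
qed

text \<open>An open triangle lies in an open unit square, which no other closed grid square meets;
  inside one square the diagonals separate the four triangles.\<close>

lemma open_tri_tri_disjoint:
  assumes "p \<in> open_tri s" "p \<in> tri t"
  shows "t = s"
proof -
  obtain a b q where s: "s = (a, b, q)" by (cases s)
  obtain a' b' q' where t: "t = (a', b', q')" by (cases t)
  obtain x y where p: "p = (x, y)" by (cases p)
  have "real_of_int a < x" "x < a + 1" "real_of_int b < y" "y < b + 1"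
    using assms(1) by (auto simp: s p open_tri_def split: quarter.splits)
  moreover have "real_of_int a' \<le> x" "x \<le> a' + 1" "real_of_int b' \<le> y" "y \<le> b' + 1"
    using assms(2) by (auto simp: t p tri_eq_closed_tri closed_tri_def split: quarter.splits)
  ultimately have "a = a'" "b = b'" by linarith+
  with assms show ?thesis
    by (auto simp: s t p tri_eq_closed_tri closed_tri_def open_tri_def split: quarter.splits)
qed

text \<open>On the segment from \<open>p\<close> to an inner point \<open>c\<close>, the points
  strictly between are inner points and tend to \<open>p\<close>.\<close>

lemma tri_subset_closure_open_tri: "tri t \<subseteq> closure (open_tri t)"
proof
  fix p assume p: "p \<in> tri t"
  obtain c where c: "c \<in> open_tri t" using open_tri_nonempty[of t] by blast
  obtain a b q where t: "t = (a, b, q)" by (cases t)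
  define f where "f e = p + e *\<^sub>R (c - p)" for e :: real
  have "f e \<in> open_tri t" if e: "0 < e" "e < 1" for e
  proof -
    obtain x y x' y' where xy: "p = (x, y)" "c = (x', y')" by (cases p; cases c)
    have f: "f e = ((1 - e) * x + e * x', (1 - e) * y + e * y')"
      by (simp add: f_def xy algebra_simps)
    \<comment> \<open>Weak inequality at \<open>p\<close> and strict inequality at \<open>c\<close>
      give strict inequality in between.\<close>
    have combine: "(1 - e) * u + e * v < (1 - e) * u' + e * v'" if "u \<le> u'" "v < v'" for u v u' v'
      using that e by (intro add_le_less_mono mult_left_mono mult_strict_left_mono) auto
    have aff: "(1 - e) * k + e * k = k" for k by (simp add: algebra_simps)
    show ?thesis
    proof (cases q)
      case QBot
      then have "b \<le> y" "y - b \<le> x - a" "(x - a) + (y - b) \<le> 1"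
        "b < y'" "y' - b < x' - a" "(x' - a) + (y' - b) < 1"
        using p c by (auto simp: t xy tri_eq_closed_tri closed_tri_def open_tri_def)
      from combine[OF this(1,4)] combine[OF this(2,5)] combine[OF this(3,6)]
      show ?thesis by (simp add: f t QBot open_tri_def algebra_simps)
    next
      case QRgt
      then have "x \<le> a + 1" "y - b \<le> x - a" "1 \<le> (x - a) + (y - b)"
        "x' < a + 1" "y' - b < x' - a" "1 < (x' - a) + (y' - b)"
        using p c by (auto simp: t xy tri_eq_closed_tri closed_tri_def open_tri_def)
      from combine[OF this(1,4)] combine[OF this(2,5)] combine[OF this(3,6)]
      show ?thesis by (simp add: f t QRgt open_tri_def algebra_simps)
    next
      case QTop
      then have "y \<le> b + 1" "x - a \<le> y - b" "1 \<le> (x - a) + (y - b)"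
        "y' < b + 1" "x' - a < y' - b" "1 < (x' - a) + (y' - b)"
        using p c by (auto simp: t xy tri_eq_closed_tri closed_tri_def open_tri_def)
      from combine[OF this(1,4)] combine[OF this(2,5)] combine[OF this(3,6)]
      show ?thesis by (simp add: f t QTop open_tri_def algebra_simps)
    next
      case QLft
      then have "a \<le> x" "x - a \<le> y - b" "(x - a) + (y - b) \<le> 1"
        "a < x'" "x' - a < y' - b" "(x' - a) + (y' - b) < 1"
        using p c by (auto simp: t xy tri_eq_closed_tri closed_tri_def open_tri_def)
      from combine[OF this(1,4)] combine[OF this(2,5)] combine[OF this(3,6)]
      show ?thesis by (simp add: f t QLft open_tri_def algebra_simps)
    qed
  qed
  \<comment> \<open>Two successors keep the weight strictly below 1.\<close>
  then have "\<And>n. f (1 / of_nat (Suc (Suc n))) \<in> open_tri t" by simp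
  moreover have "(\<lambda>n. f (1 / of_nat (Suc (Suc n)))) \<longlonglongrightarrow> f 0"
    unfolding f_def
    by (intro tendsto_intros LIMSEQ_Suc[OF LIMSEQ_Suc[OF lim_1_over_n]])
  ultimately show "p \<in> closure (open_tri t)"
    unfolding closure_sequential by (intro exI[of _ "\<lambda>n. f (1 / of_nat (Suc (Suc n)))"]) (simp add: f_def)
qed

section \<open>Regions and their lattice points\<close>

lemma closure_region:
  assumes "finite T"
  shows "closure (region T) = \<Union> (tri ` T)"
proof (rule antisym)
  have "closed (tri t)" for t
    unfolding tri_def tri_verts_def by (intro compact_imp_closed compact_convex_hull finite_imp_compact) simp
  then show "closure (region T) \<subseteq> \<Union> (tri ` T)"
    unfolding region_def using assms by (intro closure_minimal interior_subset closed_UN) auto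
  have "open_tri t \<subseteq> region T" if "t \<in> T" for t
    unfolding region_def using that open_tri_subset by (intro interior_maximal open_open_tri) blast
  then show "\<Union> (tri ` T) \<subseteq> closure (region T)"
    using tri_subset_closure_open_tri closure_mono by blast
qed

lemma open_region: "open (region T)"
  by (simp add: region_def)

lemma tri_subset_region_closure: "finite T \<Longrightarrow> t \<in> T \<Longrightarrow> tri t \<subseteq> closure (region T)"
  by (auto simp: closure_region)

lemma region_nonempty: "finite T \<Longrightarrow> T \<noteq> {} \<Longrightarrow> region T \<noteq> {}"
  using tri_subset_region_closure open_tri_nonempty open_tri_subset closure_empty
  by (metis all_not_in_conv subset_empty subset_trans)

lemma open_tri_meets_tri: "p \<in> open_tri t \<Longrightarrow> p \<in> \<Union> (tri ` T) \<Longrightarrow> t \<in> T"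
  using open_tri_tri_disjoint by blast

lemma open_meets_open_tri:
  assumes "open U" "p \<in> U" "p \<in> tri t"
  obtains z where "z \<in> U" "z \<in> open_tri t"
  using assms tri_subset_closure_open_tri by (meson closure_iff_nhds_not_empty disjoint_iff subsetD subset_refl)

text \<open>Makes \<open>GammaP\<close> combinatorial. Every triangle at \<open>v\<close> has inner
  points arbitrarily near \<open>v\<close>, and together the eight surround it.\<close>

lemma lattice_pt_in_region_iff:
  "lattice_pt v \<in> region T \<longleftrightarrow> (\<forall>d. sector v d \<in> T)"
proof
  assume v: "lattice_pt v \<in> region T"
  show "\<forall>d. sector v d \<in> T"
  proof
    fix d
    have "lattice_pt v \<in> tri (sector v d)"
      unfolding tri_def tri_verts_sector by (intro hull_inc) simp
    from open_meets_open_tri[OF open_region v this] obtain z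
      where "z \<in> region T" "z \<in> open_tri (sector v d)" .
    then show "sector v d \<in> T"
      using interior_subset open_tri_meets_tri unfolding region_def by blast
  qed
next
  assume T: "\<forall>d. sector v d \<in> T"
  obtain a b where v: "v = (a, b)" by (cases v)
  \<comment> \<open>The triangles at \<open>v\<close> fill exactly the closed unit ball of the
    1-norm, of which this is the interior.\<close>
  define W where "W = {p :: pt. \<bar>fst p - a\<bar> + \<bar>snd p - b\<bar> < 1}"
  have "open W" unfolding W_def by (intro open_Collect_less continuous_intros)
  moreover have "W \<subseteq> \<Union> (tri ` T)"
  proof
    fix p assume "p \<in> W"
    then obtain x y where p: "p = (x, y)" and xy: "\<bar>x - a\<bar> + \<bar>y - b\<bar> < 1"
      by (cases p) (auto simp: W_def)
    have "\<exists>d\<in>{0,1,2,3,4,5,6,7}. p \<in> tri (sector v d)"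
      using xy by (auto simp: sector_def v p tri_eq_closed_tri closed_tri_def abs_if split: if_splits)
    then show "p \<in> \<Union> (tri ` T)" using T by blast
  qed
  ultimately show "lattice_pt v \<in> region T"
    unfolding region_def by (intro interiorI[of W]) (simp_all add: W_def v lattice_pt_def)
qed

lemma GammaP_iff: "v \<in> GammaP T \<longleftrightarrow> (\<forall>d. sector v d \<in> T)"
  unfolding lattice_pt_in_region_iff[symmetric]
  by (cases v) (simp add: GammaP_def lattice_pt_def)

lemma finite_GammaP:
  assumes "finite T"
  shows "finite (GammaP T)"
proof (rule finite_imageD)
  show "finite ((\<lambda>v. sector v 0) ` GammaP T)"
    using assms by (rule finite_subset[rotated]) (auto simp: GammaP_iff)
  show "inj_on (\<lambda>v. sector v 0) (GammaP T)" using sector_inj by (auto intro!: inj_onI)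
qed

section \<open>Automorphisms on points, hulls and directions\<close>

definition linear_part :: "bool \<Rightarrow> int \<Rightarrow> int \<Rightarrow> pt \<Rightarrow> pt" where
  "linear_part sw s1 s2 p = (let (u, v) = (if sw then (snd p, fst p) else p)
      in (of_int s1 * u, of_int s2 * v))"

lemma aut_map_eq: "aut_map sw s1 s2 t1 t2 p = linear_part sw s1 s2 p + lattice_pt (t1, t2)"
  by (cases p) (simp add: aut_map_def linear_part_def lattice_pt_def)

lemma linear_linear_part: "linear (linear_part sw s1 s2)"
  by (rule linearI) (auto simp: linear_part_def algebra_simps split: prod.splits)

lemma aut_map_continuous: "continuous_on S (aut_map sw s1 s2 t1 t2)"
  unfolding aut_map_eq[abs_def]
  by (intro continuous_intros linear_continuous_on linear_linear_part
      linear_conv_bounded_linear[THEN iffD1])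

lemma aut_map_image_hull:
  "aut_map sw s1 s2 t1 t2 ` (convex hull S) = convex hull (aut_map sw s1 s2 t1 t2 ` S)"
proof -
  have "aut_map sw s1 s2 t1 t2 ` A = (+) (lattice_pt (t1, t2)) ` linear_part sw s1 s2 ` A" for A
    by (simp add: image_image aut_map_eq[abs_def] add.commute)
  then show ?thesis
    by (simp add: convex_hull_translation convex_hull_linear_image[OF linear_linear_part])
qed

lemma aut_map_inverse:
  assumes "s1 \<in> {-1, 1}" "s2 \<in> {-1, 1}"
  obtains g' where "continuous_on UNIV g'" "\<And>p. g' (aut_map sw s1 s2 t1 t2 p) = p"
    "\<And>p. aut_map sw s1 s2 t1 t2 (g' p) = p"
proof
  \<comment> \<open>If the coordinates are swapped, the inverse also swaps them, which exchanges the
    roles of the two signs and shifts.\<close>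
  let ?g' = "if sw then aut_map sw s2 s1 (- s2 * t2) (- s1 * t1) else aut_map sw s1 s2 (- s1 * t1) (- s2 * t2)"
  show "continuous_on UNIV ?g'" by (simp add: aut_map_continuous)
  show "\<And>p. ?g' (aut_map sw s1 s2 t1 t2 p) = p" "\<And>p. aut_map sw s1 s2 t1 t2 (?g' p) = p"
    using assms by (auto simp: aut_map_def)
qed

text \<open>An automorphism acts on the eight directions as \<open>d \<mapsto> c' + \<epsilon> d\<close>; the data below
  describe its inverse, \<open>\<epsilon>\<close> being the determinant.\<close>

lemma Aut_M_action:
  assumes "g \<in> Aut_M"
  obtains \<kappa> c \<epsilon> where "\<epsilon> \<in> {-1, 1 :: int}" "even c" "surj \<kappa>"
    "\<And>v. g (lattice_pt (\<kappa> v)) = lattice_pt v"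
    "\<And>v d. g (lattice_pt (\<kappa> v) + dvec (c + \<epsilon> * d)) = lattice_pt v + dvec d"
proof -
  obtain sw s1 s2 t1 t2 where g: "g = aut_map sw s1 s2 t1 t2" and s: "s1 \<in> {-1, 1}" "s2 \<in> {-1, 1}"
    using assms unfolding Aut_M_def by blast
  define \<epsilon> where "\<epsilon> = (if sw then - s1 * s2 else s1 * s2)"
  \<comment> \<open>The direction that the linear part turns into direction 0.\<close>
  define c :: int where "c = (if sw then (if s1 = 1 then 2 else 6) else if s1 = 1 then 0 else 4)"
  define \<kappa> where "\<kappa> v = (if sw then (s2 * (snd v - t2), s1 * (fst v - t1))
    else (s1 * (fst v - t1), s2 * (snd v - t2)))" for v
  have \<kappa>: "g (lattice_pt (\<kappa> v)) = lattice_pt v" for v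
    using s by (auto simp: g aut_map_def \<kappa>_def lattice_pt_def)
  have "linear_part sw s1 s2 (dvec (c + \<epsilon> * d)) = dvec d" for d
  proof -
    have "wave (d + 6) = - wave (d + 2)" "wave (d + 8) = wave d"
      using wave_add_4[of "d + 2"] wave_add_4[of "d + 4"] wave_add_4[of d] by (simp_all add: algebra_simps)
    moreover have "wave (2 - d) = - wave (d + 2)" "wave (4 - d) = - wave d"
      "wave (6 - d) = wave (d + 2)" "wave (8 - d) = wave d"
      using wave_diff(1)[of d] wave_minus[of "d - 2"] wave_minus[of d] wave_add_4[of "- d"]
        wave_add_4[of "2 - d"] wave_add_4[of "4 - d"] by simp_all
    ultimately show ?thesis
      unfolding linear_part_def dvec_def wave_diff
      using s by (cases sw) (auto simp: c_def \<epsilon>_def wave_minus wave_add_4 algebra_simps)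
  qed
  moreover have "linear_part sw s1 s2 (lattice_pt (\<kappa> v)) + lattice_pt (t1, t2) = lattice_pt v" for v
    using \<kappa>[of v] by (simp add: g aut_map_eq)
  ultimately have dir: "g (lattice_pt (\<kappa> v) + dvec (c + \<epsilon> * d)) = lattice_pt v + dvec d" for v d
    unfolding g aut_map_eq linear_add[OF linear_linear_part] by (metis add.assoc add.commute)
  have "\<exists>v. w = \<kappa> v" for w
    using s by (intro exI[of _ "if sw then (t1 + s1 * snd w, t2 + s2 * fst w)
      else (t1 + s1 * fst w, t2 + s2 * snd w)"]) (auto simp: \<kappa>_def)
  then have "surj \<kappa>" by (simp add: surj_def)
  moreover have "\<epsilon> \<in> {-1, 1}" using s by (auto simp: \<epsilon>_def)
  moreover have "even c" by (simp add: c_def)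
  ultimately show ?thesis using that \<kappa> dir by blast
qed

section \<open>Unfolding along a reflective tiling\<close>

text \<open>\<open>w\<close> names the tile of each sector, and a wall lies at edge 0. Reflections
  carry walls to walls, so the distance to the next wall decides everything; only 1, 2 and 4 steps
  are consistent. Congruences in the hypotheses allow instances with numerals.\<close>

lemma kaleidoscope_at_0:
  fixes w :: "int \<Rightarrow> nat" and a :: "int \<Rightarrow> int"
  assumes mirror: "\<And>p e d d'. (p + 1 - e) mod 8 = 0 \<Longrightarrow> (d + d' + 1 - 2 * e) mod 8 = 0 \<Longrightarrow>
      w p \<noteq> w e \<Longrightarrow> w d = w p \<longleftrightarrow> w d' = w e"
    and vanish: "\<And>p e. (p + 1 - e) mod 8 = 0 \<Longrightarrow> w p \<noteq> w e \<Longrightarrow> a e = 0"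
    and odd: "\<And>p e c d d'. (p + 1 - e) mod 8 = 0 \<Longrightarrow> (c + 1 - d) mod 8 = 0 \<Longrightarrow>
      (d + d' - 2 * e) mod 8 = 0 \<Longrightarrow> w p \<noteq> w e \<Longrightarrow> w c = w p \<Longrightarrow> w d = w p \<Longrightarrow> a d' = - a d"
    and wall: "w 7 \<noteq> w 0"
  shows "a 0 + a 1 + a 2 + a 3 + a 4 + a 5 + a 6 + a 7 = 0"
proof -
  have a0: "a 0 = 0" using vanish[of 7 0] wall by simp
  consider (1) "w 0 \<noteq> w 1" | (2) "w 0 = w 1" "w 1 \<noteq> w 2"
    | (3) "w 0 = w 1" "w 1 = w 2" "w 2 \<noteq> w 3"
    | (4) "w 0 = w 1" "w 1 = w 2" "w 2 = w 3" "w 3 \<noteq> w 4"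
    | (5) "w 0 = w 1" "w 1 = w 2" "w 2 = w 3" "w 3 = w 4" by blast
  then show ?thesis
  proof cases
    case 1
    \<comment> \<open>Spacing 1: each wall reflects its predecessor to a successor, so all eight
      edges are walls.\<close>
    then have 2: "w 1 \<noteq> w 2" using mirror[of 0 1 7 2] wall by simp
    then have 3: "w 2 \<noteq> w 3" using mirror[of 1 2 0 3] 1 by simp
    then have 4: "w 3 \<noteq> w 4" using mirror[of 2 3 1 4] 2 by simp
    then have 5: "w 4 \<noteq> w 5" using mirror[of 3 4 2 5] 3 by simp
    then have 6: "w 5 \<noteq> w 6" using mirror[of 4 5 3 6] 4 by simp
    then have 7: "w 6 \<noteq> w 7" using mirror[of 5 6 4 7] 5 by simp
    show ?thesis
      using a0 vanish[of 0 1] vanish[of 1 2] vanish[of 2 3] vanish[of 3 4] vanish[of 4 5]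
        vanish[of 5 6] vanish[of 6 7] 1 2 3 4 5 6 7 by simp
  next
    case 2
    \<comment> \<open>Spacing 2: the even edges are walls, and the values at odd edges alternate in
      sign.\<close>
    have 3: "w 3 = w 2" using mirror[of 1 2 0 3] 2 by simp
    have 4: "w 3 \<noteq> w 4" using mirror[of 1 2 7 4] 2 3 wall by simp
    have 5: "w 5 = w 4" using mirror[of 3 4 2 5] 3 4 by simp
    have 6: "w 5 \<noteq> w 6" using mirror[of 3 4 1 6] 2 3 4 5 by simp
    have "a 3 = - a 1" using odd[of 1 2 0 1 3] 2 by simp
    moreover have "a 5 = - a 3" by (rule odd[of 3 4 2 3 5]) (use 3 4 in simp_all)
    moreover have "a 7 = - a 5" by (rule odd[of 5 6 4 5 7]) (use 5 6 in simp_all)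
    moreover have "a 2 = 0" "a 4 = 0" "a 6 = 0"
      using vanish[of 1 2] vanish[of 3 4] vanish[of 5 6] 2 4 6 by simp_all
    ultimately show ?thesis using a0 by simp
  next
    case 3
    \<comment> \<open>Spacing 3 does not divide the full turn: past the wall at 6, sectors 6, 7 and
      0 would share a tile, contradicting the wall at 0.\<close>
    have "w 4 = w 3" "w 5 = w 3" using mirror[of 2 3 1 4] mirror[of 2 3 0 5] 3 by simp_all
    moreover have "w 6 \<noteq> w 3" using mirror[of 2 3 7 6] 3 wall by simp
    ultimately have "w 7 = w 6" "w 0 = w 6"
      using mirror[of 5 6 4 7] mirror[of 5 6 3 0] by simp_all
    with wall show ?thesis by simp
  next
    case 4
    \<comment> \<open>Spacing 4: a straight wall, across which the values cancel in mirrored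
      pairs.\<close>
    then have "a 5 = - a 3" "a 6 = - a 2" "a 7 = - a 1"
      using odd[of 3 4 2 3 5] odd[of 3 4 1 2 6] odd[of 3 4 0 1 7] by simp_all
    moreover have "a 4 = 0" using vanish[of 3 4] 4 by simp
    ultimately show ?thesis using a0 by simp
  next
    case 5
    \<comment> \<open>Sectors 3 and 4 are mirror images in wall 0, so they cannot both belong to the
      tile of sector 0.\<close>
    then show ?thesis using mirror[of 7 0 3 4] wall by simp
  qed
qed

lemma sum_period_8:
  fixes a :: "int \<Rightarrow> 'a :: comm_monoid_add"
  assumes per: "\<And>d d'. d mod 8 = d' mod 8 \<Longrightarrow> a d = a d'"
  shows "a e + a (e + 1) + a (e + 2) + a (e + 3) + a (e + 4) + a (e + 5) + a (e + 6) + a (e + 7)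
    = a 0 + a 1 + a 2 + a 3 + a 4 + a 5 + a 6 + a 7"
proof -
  have "a d = a (d mod 8)" for d by (rule per) simp
  then have red: "a (8 * q + k) = a (k mod 8)" "a (8 * q) = a 0" for q k
    by (metis mod_mult_self4, metis mod_mult_self1_is_0)
  show ?thesis
    by (cases e rule: mod8_cases) (simp_all add: red add.assoc, simp_all add: ac_simps)
qed

lemma mod_eqI: "c mod m = 0 \<Longrightarrow> a - b = - c \<Longrightarrow> a mod m = b mod (m :: int)"
  by (simp add: mod_eq_dvd_iff mod_eq_0_iff_dvd)

text \<open>Eight sectors around a point are distributed among tiles that reflect into each other
  across every wall, so walls are equally spaced and the values \<open>a\<close> cancel in pairs.\<close>

lemma kaleidoscope:
  fixes w :: "int \<Rightarrow> nat" and a :: "int \<Rightarrow> int"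
  assumes per_w: "\<And>d d'. d mod 8 = d' mod 8 \<Longrightarrow> w d = w d'"
    and per_a: "\<And>d d'. d mod 8 = d' mod 8 \<Longrightarrow> a d = a d'"
    and mirror: "\<And>e d. w (e - 1) \<noteq> w e \<Longrightarrow> w d = w (e - 1) \<longleftrightarrow> w (2 * e - 1 - d) = w e"
    and vanish: "\<And>e. w (e - 1) \<noteq> w e \<Longrightarrow> a e = 0"
    and odd: "\<And>e d. w (e - 1) \<noteq> w e \<Longrightarrow> w (d - 1) = w (e - 1) \<Longrightarrow> w d = w (e - 1) \<Longrightarrow>
      a (2 * e - d) = - a d"
    and wall: "w (e - 1) \<noteq> w e"
  shows "a 0 + a 1 + a 2 + a 3 + a 4 + a 5 + a 6 + a 7 = 0"
proof -
  \<comment> \<open>Rotation by \<open>e\<close> moves the given wall to edge 0.\<close>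
  define w' where "w' d = w (e + d)" for d
  define a' where "a' d = a (e + d)" for d
  have pred: "w (e + k - 1) = w' p" if "(p + 1 - k) mod 8 = 0" for p k
    unfolding w'_def by (rule per_w, rule mod_eqI[OF that]) simp
  have "a' 0 + a' 1 + a' 2 + a' 3 + a' 4 + a' 5 + a' 6 + a' 7 = 0"
  proof (rule kaleidoscope_at_0[where w = w'])
    fix p k d d' :: int
    assume p: "(p + 1 - k) mod 8 = 0" and d: "(d + d' + 1 - 2 * k) mod 8 = 0" and neq: "w' p \<noteq> w' k"
    have "w (2 * (e + k) - 1 - (e + d)) = w' d'"
      unfolding w'_def by (rule per_w, rule mod_eqI[OF d]) simp
    with mirror[of "e + k" "e + d"] neq show "w' d = w' p \<longleftrightarrow> w' d' = w' k"
      unfolding pred[OF p] by (simp add: w'_def)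
  next
    fix p k :: int
    assume p: "(p + 1 - k) mod 8 = 0" and neq: "w' p \<noteq> w' k"
    with vanish[of "e + k"] show "a' k = 0" unfolding pred[OF p] by (simp add: w'_def a'_def)
  next
    fix p k c d d' :: int
    assume p: "(p + 1 - k) mod 8 = 0" and c: "(c + 1 - d) mod 8 = 0"
      and d: "(d + d' - 2 * k) mod 8 = 0" and eq: "w' p \<noteq> w' k" "w' c = w' p" "w' d = w' p"
    have "a (2 * (e + k) - (e + d)) = a' d'"
      unfolding a'_def by (rule per_a, rule mod_eqI[OF d]) simp
    with odd[of "e + k" "e + d"] eq show "a' d' = - a' d"
      unfolding pred[OF p] pred[OF c] by (simp add: w'_def a'_def)
  next
    have "w (e - 1) = w' 7" using pred[of 7 0] by simp
    with wall show "w' 7 \<noteq> w' 0" by (simp add: w'_def)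
  qed
  then show ?thesis using sum_period_8[of a e, OF per_a] by (simp add: a'_def)
qed

section \<open>Neighbour sums and reflected directions\<close>

lemma ivec_cong: "d mod 8 = d' mod 8 \<Longrightarrow> ivec d = ivec d'"
  by (simp only: ivec_def)

lemma sum_nbrs: "(\<Sum>w\<leftarrow>nbrs v. f w) = f (v + ivec 0) + f (v + ivec 2) + f (v + ivec 4) + f (v + ivec 6)"
  for f :: "int \<times> int \<Rightarrow> int"
  by (cases v) (simp add: nbrs_def ivec_def)

text \<open>The four directions run through the even residues modulo 8, clockwise if
  \<open>\<epsilon> = -1\<close>.\<close>

lemma sum_nbrs_rotate:
  fixes f :: "int \<times> int \<Rightarrow> int"
  assumes "even c" "\<epsilon> \<in> {-1, 1 :: int}"
  shows "f (v + ivec c) + f (v + ivec (c + \<epsilon> * 2)) + f (v + ivec (c + \<epsilon> * 4)) + f (v + ivec (c + \<epsilon> * 6))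
    = (\<Sum>w\<leftarrow>nbrs v. f w)"
proof -
  have "ivec (c - 2) = ivec (c + 6)" "ivec (c - 4) = ivec (c + 4)" "ivec (c - 6) = ivec (c + 2)"
    by (rule ivec_cong, simp add: mod_eq_dvd_iff)+
  then have "f (v + ivec c) + f (v + ivec (c + \<epsilon> * 2)) + f (v + ivec (c + \<epsilon> * 4)) + f (v + ivec (c + \<epsilon> * 6))
    = f (v + ivec c) + f (v + ivec (c + 2)) + f (v + ivec (c + 4)) + f (v + ivec (c + 6))"
    using assms(2) by auto
  also have "\<dots> = (\<Sum>w\<leftarrow>nbrs v. f w)"
    using assms(1) unfolding sum_nbrs by (cases c rule: mod8_cases) (simp_all add: ivec_def)
  finally show ?thesis .
qed

text \<open>Two tiles of opposite orientation that agree on edge \<open>e\<close> agree up to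
  reflection in it. Edge \<open>d\<close> reflects to \<open>2 * e - d\<close>; sector
  \<open>d\<close>, lying between edges \<open>d\<close> and \<open>d + 1\<close>, to
  \<open>2 * e - 1 - d\<close>.\<close>

lemma reflected_index:
  fixes x y d e \<epsilon> :: int
  assumes "\<epsilon> \<in> {-1, 1}" "(x + \<epsilon> * e) mod 8 = (y + - \<epsilon> * e) mod 8"
  shows "(x + \<epsilon> * d) mod 8 = (y + - \<epsilon> * (2 * e - d)) mod 8"
    and "(x + \<epsilon> * d + (\<epsilon> - 1) div 2) mod 8
      = (y + - \<epsilon> * (2 * e - 1 - d) + (- \<epsilon> - 1) div 2) mod 8"
  using assms by (auto simp: mod_eq_dvd_iff algebra_simps)

text \<open>\<open>own i t\<close> says that the triangle \<open>t\<close> lies in the \<open>i\<close>-th tile; \<open>\<kappa> i\<close>, \<open>c i\<close> and \<open>\<epsilon> i\<close> describe the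
  inverse of the \<open>i\<close>-th automorphism, an orientation-reversing one shifting sector numbers by \<open>-1\<close>.\<close>

locale folded_tiling =
  fixes S T :: "trid set" and n :: nat and \<kappa> :: "nat \<Rightarrow> int \<times> int \<Rightarrow> int \<times> int"
    and c \<epsilon> :: "nat \<Rightarrow> int" and own :: "nat \<Rightarrow> trid \<Rightarrow> bool"
  assumes fin: "finite S" "finite T" and n_pos: "0 < n"
    and eps: "i < n \<Longrightarrow> \<epsilon> i \<in> {-1, 1}" and c_even: "i < n \<Longrightarrow> even (c i)"
    and surj: "i < n \<Longrightarrow> surj (\<kappa> i)"
    and shift: "i < n \<Longrightarrow> even d \<Longrightarrow> \<kappa> i (v + ivec d) = \<kappa> i v + ivec (c i + \<epsilon> i * d)"
    and own_sector: "i < n \<Longrightarrow> own i (sector v d) \<longleftrightarrow> sector (\<kappa> i v) (c i + \<epsilon> i * d + (\<epsilon> i - 1) div 2) \<in> S"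
    and cover: "t \<in> T \<longleftrightarrow> (\<exists>i<n. own i t)"
    and disjoint: "i < n \<Longrightarrow> j < n \<Longrightarrow> own i t \<Longrightarrow> own j t \<Longrightarrow> i = j"
    and fold: "i < n \<Longrightarrow> j < n \<Longrightarrow> i \<noteq> j \<Longrightarrow> own i (sector v (d - 1)) \<Longrightarrow> own j (sector v d) \<Longrightarrow>
      \<kappa> i v = \<kappa> j v \<and> (c i + \<epsilon> i * d) mod 8 = (c j + \<epsilon> j * d) mod 8"
begin

text \<open>For \<open>f\<close> supported on \<open>GammaP S\<close> at most one summand is
  nonzero, as a point is interior to at most one tile; the sum makes linearity immediate.\<close>

definition unfold :: "((int \<times> int) \<Rightarrow> int) \<Rightarrow> (int \<times> int) \<Rightarrow> int" where
  "unfold f v = (\<Sum>i<n. \<epsilon> i * f (\<kappa> i v))"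

lemma interior_iff:
  assumes "i < n"
  shows "\<kappa> i v \<in> GammaP S \<longleftrightarrow> (\<forall>d. own i (sector v d))"
proof
  assume own: "\<forall>d. own i (sector v d)"
  have "sector (\<kappa> i v) e \<in> S" for e
  proof -
    \<comment> \<open>Solves for the sector number that is carried to \<open>e\<close>, using that
      \<open>\<epsilon> i\<close> is its own inverse.\<close>
    have "c i + \<epsilon> i * (\<epsilon> i * (e - c i - (\<epsilon> i - 1) div 2)) + (\<epsilon> i - 1) div 2 = e"
      using eps[OF assms] by auto
    then show ?thesis using own own_sector[OF assms] by metis
  qed
  then show "\<kappa> i v \<in> GammaP S" by (simp add: GammaP_iff)
qed (simp add: GammaP_iff own_sector[OF assms])

text \<open>A tile owns all triangles around its interior points, among them the two along the edge
  back to \<open>v\<close>.\<close>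

lemma own_of_interior_neighbour:
  assumes "i < n" "even d" "\<kappa> i (v + ivec d) \<in> GammaP S"
  shows "own i (sector v d)" "own i (sector v (d - 1))"
  using assms interior_iff sector_shift[OF assms(2)] by metis+

lemma unfold_eq_single:
  assumes f: "f \<in> carrier (Zfun (GammaP S))" and i: "i < n"
    and other: "\<And>j. j < n \<Longrightarrow> \<kappa> j v \<in> GammaP S \<Longrightarrow> j = i"
  shows "unfold f v = \<epsilon> i * f (\<kappa> i v)"
proof -
  have "unfold f v = (\<Sum>j\<in>{i}. \<epsilon> j * f (\<kappa> j v))"
    unfolding unfold_def
  proof (rule sum.mono_neutral_right)
    show "\<forall>j\<in>{..<n} - {i}. \<epsilon> j * f (\<kappa> j v) = 0"
    proof
      fix j assume "j \<in> {..<n} - {i}"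
      then have "\<kappa> j v \<notin> GammaP S" using other[of j] by blast
      then show "\<epsilon> j * f (\<kappa> j v) = 0" by (simp add: Zfun_eq_0[OF f])
    qed
  qed (use i in auto)
  then show ?thesis by simp
qed

lemma unfold_eq_0:
  assumes f: "f \<in> carrier (Zfun (GammaP S))" and none: "\<And>j. j < n \<Longrightarrow> \<kappa> j v \<notin> GammaP S"
  shows "unfold f v = 0"
  unfolding unfold_def using none Zfun_eq_0[OF f] by (intro sum.neutral) auto

lemma unfold_closed:
  assumes "f \<in> carrier (Zfun (GammaP S))"
  shows "unfold f \<in> carrier (Zfun (GammaP T))"
proof -
  have "unfold f v = 0" if "v \<notin> GammaP T" for v
  proof (rule unfold_eq_0[OF assms])
    fix j assume "j < n"
    then show "\<kappa> j v \<notin> GammaP S"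
      using that interior_iff[of j v] GammaP_iff[of v T] cover by blast
  qed
  then show ?thesis by (simp add: Zfun_def)
qed

text \<open>A neighbour of \<open>v\<close> may leave the interior of tile \<open>i\<close>, but not
  into the interior of another tile, which would then own a triangle at \<open>v\<close>.\<close>

lemma unfold_at_interior:
  assumes f: "f \<in> carrier (Zfun (GammaP S))" and i: "i < n" and v: "\<kappa> i v \<in> GammaP S"
  shows "unfold f v = \<epsilon> i * f (\<kappa> i v)"
    and "even d \<Longrightarrow> unfold f (v + ivec d) = \<epsilon> i * f (\<kappa> i v + ivec (c i + \<epsilon> i * d))"
proof -
  have own: "own i (sector v d)" for d using v i by (simp add: interior_iff)
  show "unfold f v = \<epsilon> i * f (\<kappa> i v)"
  proof (rule unfold_eq_single[OF f i])
    fix j assume j: "j < n" "\<kappa> j v \<in> GammaP S"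
    then have "own j (sector v 0)" by (simp add: interior_iff)
    then show "j = i" using disjoint own i j by blast
  qed
  assume d: "even d"
  have "unfold f (v + ivec d) = \<epsilon> i * f (\<kappa> i (v + ivec d))"
  proof (rule unfold_eq_single[OF f i])
    fix j assume j: "j < n" "\<kappa> j (v + ivec d) \<in> GammaP S"
    then have "own j (sector v d)" using d own_of_interior_neighbour by blast
    then show "j = i" using disjoint own i j by blast
  qed
  then show "unfold f (v + ivec d) = \<epsilon> i * f (\<kappa> i v + ivec (c i + \<epsilon> i * d))"
    by (simp add: shift[OF i d])
qed

text \<open>Around \<open>v\<close> the tiles are mirror images across their walls and
  \<open>unfold f\<close> is odd under these reflections, so \<open>kaleidoscope\<close>
  applies.\<close>

lemma sum_nbrs_at_wall:
  assumes f: "f \<in> carrier (Zfun (GammaP S))" and v: "v \<in> GammaP T"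
    and none: "\<And>i. i < n \<Longrightarrow> \<kappa> i v \<notin> GammaP S"
  shows "(\<Sum>w\<leftarrow>nbrs v. unfold f w) = 0"
proof -
  define w where "w d = (SOME i. i < n \<and> own i (sector v d))" for d
  \<comment> \<open>Odd directions lead to centres of squares, which carry no value.\<close>
  define a where "a d = (if even d then unfold f (v + ivec d) else 0)" for d
  have w: "w d < n" "own (w d) (sector v d)" for d
  proof -
    have "\<exists>i. i < n \<and> own i (sector v d)" using v unfolding GammaP_iff cover by blast
    from someI_ex[OF this] show "w d < n" "own (w d) (sector v d)" by (simp_all add: w_def)
  qed
  have w_eq: "own i (sector v d) \<longleftrightarrow> w d = i" if "i < n" for i d
    using w disjoint that by blast
  have per_w: "w d = w d'" if "d mod 8 = d' mod 8" for d d'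
    using sector_cong[OF that, of v] by (simp add: w_def)
  have flip: "\<kappa> (w (e - 1)) v = \<kappa> (w e) v \<and> \<epsilon> (w e) = - \<epsilon> (w (e - 1))
      \<and> (c (w (e - 1)) + \<epsilon> (w (e - 1)) * e) mod 8 = (c (w e) + \<epsilon> (w e) * e) mod 8"
    if neq: "w (e - 1) \<noteq> w e" for e
  proof -
    let ?i = "w (e - 1)" and ?j = "w e"
    have eq: "\<kappa> ?i v = \<kappa> ?j v" "(c ?i + \<epsilon> ?i * e) mod 8 = (c ?j + \<epsilon> ?j * e) mod 8"
      using fold[OF w(1) w(1) neq w(2) w(2)] by simp_all
    \<comment> \<open>With equal orientations both tiles would pull sector \<open>e\<close> back to
      the same triangle, and \<open>?i\<close> would own it too.\<close>
    have "\<epsilon> ?i \<noteq> \<epsilon> ?j"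
    proof
      assume "\<epsilon> ?i = \<epsilon> ?j"
      then have "(c ?i + \<epsilon> ?i * e + (\<epsilon> ?i - 1) div 2) mod 8 = (c ?j + \<epsilon> ?j * e + (\<epsilon> ?j - 1) div 2) mod 8"
        using mod_add_cong[OF eq(2) refl] by simp
      from sector_cong[OF this, of "\<kappa> ?i v"] have "own ?i (sector v e)"
        using own_sector[OF w(1)] w(2)[of e] eq(1) by simp
      then show False using w_eq[OF w(1)] neq by metis
    qed
    then show ?thesis using eq eps[OF w(1)[of e]] eps[OF w(1)[of "e - 1"]] by auto
  qed
  have mirror: "w d = w (e - 1) \<longleftrightarrow> w (2 * e - 1 - d) = w e" if "w (e - 1) \<noteq> w e" for e d
  proof -
    note flip = flip[OF that]
    let ?i = "w (e - 1)" and ?j = "w e"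
    have "(c ?i + \<epsilon> ?i * d + (\<epsilon> ?i - 1) div 2) mod 8
        = (c ?j + \<epsilon> ?j * (2 * e - 1 - d) + (\<epsilon> ?j - 1) div 2) mod 8"
      using reflected_index(2)[OF eps[OF w(1)]] flip by simp
    from sector_cong[OF this, of "\<kappa> ?i v"]
    have "own ?i (sector v d) \<longleftrightarrow> own ?j (sector v (2 * e - 1 - d))"
      using own_sector[OF w(1)] flip by metis
    then show ?thesis by (simp add: w_eq w(1))
  qed
  have "a 0 + a 1 + a 2 + a 3 + a 4 + a 5 + a 6 + a 7 = 0"
  proof -
    \<comment> \<open>Without a wall one tile owns all sectors at \<open>v\<close>, making
      \<open>v\<close> interior to it.\<close>
    have "\<exists>e. w (e - 1) \<noteq> w e"
    proof (rule ccontr)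
      assume "\<not> ?thesis"
      then have step: "w (e - 1) = w e" for e by blast
      have "w (int k) = w 0" for k
      proof (induction k)
        case (Suc k) then show ?case using step[of "int (Suc k)"] by simp
      qed simp
      moreover have "w d = w (int (nat (d mod 8)))" for d by (rule per_w) simp
      ultimately have "w d = w 0" for d by metis
      then have "\<forall>d. own (w 0) (sector v d)" using w_eq[OF w(1)] by simp
      then show False using none[OF w(1)] interior_iff[OF w(1)] by blast
    qed
    then obtain e0 where wall: "w (e0 - 1) \<noteq> w e0" by blast
    show ?thesis
    proof (rule kaleidoscope[where w = w, OF per_w])
      fix d d' :: int assume eq: "d mod 8 = d' mod 8"
      then have "even d \<longleftrightarrow> even d'" using dvd_mod_iff[of 2 8 d] dvd_mod_iff[of 2 8 d'] by simp
      with ivec_cong[OF eq] show "a d = a d'" by (simp add: a_def)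
    next
      show "w (e - 1) \<noteq> w e \<Longrightarrow> w d = w (e - 1) \<longleftrightarrow> w (2 * e - 1 - d) = w e" for e d
        by (rule mirror)
    next
      fix e assume neq: "w (e - 1) \<noteq> w e"
      show "a e = 0"
      proof (cases "even e")
        case True
        \<comment> \<open>A tile containing this neighbour in its interior would own the sectors on
          both sides of the wall.\<close>
        have "unfold f (v + ivec e) = 0"
        proof (rule unfold_eq_0[OF f])
          fix j assume j: "j < n"
          show "\<kappa> j (v + ivec e) \<notin> GammaP S"
            using own_of_interior_neighbour[OF j True] w_eq[OF j] neq by metis
        qed
        then show ?thesis by (simp add: a_def)
      qed (simp add: a_def)
    next
      fix e d assume neq: "w (e - 1) \<noteq> w e" and d: "w (d - 1) = w (e - 1)" "w d = w (e - 1)"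
      note flip = flip[OF neq]
      let ?i = "w (e - 1)" and ?j = "w e"
      show "a (2 * e - d) = - a d"
      proof (cases "even d")
        case True
        then have even: "even (2 * e - d)" by simp
        have "ivec (c ?i + \<epsilon> ?i * d) = ivec (c ?j + \<epsilon> ?j * (2 * e - d))"
          by (rule ivec_cong) (use reflected_index(1)[OF eps[OF w(1)]] flip in simp)
        moreover have single: "unfold f (v + ivec k) = \<epsilon> i * f (\<kappa> i v + ivec (c i + \<epsilon> i * k))"
          if "even k" "w k = i" for k i
        proof -
          have i: "i < n" using that w(1) by blast
          have "unfold f (v + ivec k) = \<epsilon> i * f (\<kappa> i (v + ivec k))"
          proof (rule unfold_eq_single[OF f i])
            fix j assume "j < n" "\<kappa> j (v + ivec k) \<in> GammaP S"
            then show "j = i" using own_of_interior_neighbour(1)[of j k v] that w_eq[of j k] by simp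
          qed
          then show ?thesis by (simp add: shift[OF i that(1)])
        qed
        moreover have "unfold f (v + ivec d) = \<epsilon> ?i * f (\<kappa> ?i v + ivec (c ?i + \<epsilon> ?i * d))"
          using single[OF True d(2)] .
        moreover have "unfold f (v + ivec (2 * e - d))
          = \<epsilon> ?j * f (\<kappa> ?j v + ivec (c ?j + \<epsilon> ?j * (2 * e - d)))"
        proof (rule single[OF even])
          \<comment> \<open>Reflection takes sector \<open>d - 1\<close> to sector
            \<open>2 * e - d\<close>.\<close>
          show "w (2 * e - d) = ?j" using mirror[OF neq, of "d - 1"] d(1) by simp
        qed
        ultimately show ?thesis using True flip by (simp add: a_def)
      qed (simp add: a_def)
    next
      show "w (e0 - 1) \<noteq> w e0" by (rule wall)
    qed
  qed
  then show ?thesis by (simp add: sum_nbrs a_def)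
qed

text \<open>Inside a tile the automorphism permutes the neighbours; on walls both sides vanish by
  cancellation.\<close>

lemma red_lap_unfold:
  assumes f: "f \<in> carrier (Zfun (GammaP S))"
  shows "red_lap (GammaP T) (unfold f) = unfold (red_lap (GammaP S) f)"
proof
  fix v
  let ?L = "red_lap (GammaP S) f"
  consider (out) "v \<notin> GammaP T" | (int) i where "v \<in> GammaP T" "i < n" "\<kappa> i v \<in> GammaP S"
    | (wall) "v \<in> GammaP T" "\<And>i. i < n \<Longrightarrow> \<kappa> i v \<notin> GammaP S" by blast
  then show "red_lap (GammaP T) (unfold f) v = unfold ?L v"
  proof cases
    case out
    then show ?thesis
      using Zfun_eq_0[OF unfold_closed[OF red_lap_closed]] by (simp add: red_lap_def)
  next
    case int
    have "(\<Sum>w\<leftarrow>nbrs v. unfold f w) = \<epsilon> i * (\<Sum>w\<leftarrow>nbrs (\<kappa> i v). f w)"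
    proof -
      have "(\<Sum>w\<leftarrow>nbrs v. unfold f w) = \<epsilon> i * (f (\<kappa> i v + ivec (c i))
          + f (\<kappa> i v + ivec (c i + \<epsilon> i * 2)) + f (\<kappa> i v + ivec (c i + \<epsilon> i * 4))
          + f (\<kappa> i v + ivec (c i + \<epsilon> i * 6)))"
        unfolding sum_nbrs by (simp add: unfold_at_interior(2)[OF f int(2,3)] algebra_simps)
      then show ?thesis by (simp only: sum_nbrs_rotate[OF c_even[OF int(2)] eps[OF int(2)]])
    qed
    then show ?thesis
      using int unfold_at_interior(1)[OF red_lap_closed int(2,3)] unfold_at_interior(1)[OF f int(2,3)]
      by (simp add: red_lap_eq[OF f] red_lap_eq[OF unfold_closed[OF f]] algebra_simps)
  next
    case wall
    then show ?thesis
      using sum_nbrs_at_wall[OF f wall] unfold_eq_0[OF f wall(2)] unfold_eq_0[OF red_lap_closed wall(2)]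
      by (simp add: red_lap_eq[OF unfold_closed[OF f]])
  qed
qed

lemma sandpile_monomorphism_exists:
  "\<exists>h. h \<in> hom (sandpile_group (GammaP S)) (sandpile_group (GammaP T)) \<and>
       inj_on h (carrier (sandpile_group (GammaP S)))"
proof (rule sandpile_monomorphism[where E = unfold])
  show "finite (GammaP S)" "finite (GammaP T)" using fin by (simp_all add: finite_GammaP)
next
  fix k f assume f: "f \<in> carrier (Zfun (GammaP S))" and dvd: "\<forall>v. k dvd unfold f v"
  show "\<forall>v. k dvd f v"
  proof
    fix u
    show "k dvd f u"
    proof (cases "u \<in> GammaP S")
      case True
      \<comment> \<open>A single tile already displays every value of \<open>f\<close> up to
        sign.\<close>
      obtain v where v: "u = \<kappa> 0 v" using surj[OF n_pos] by (metis surjD)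
      then have "unfold f v = \<epsilon> 0 * f u" using unfold_at_interior(1)[OF f n_pos] True by simp
      with dvd have "k dvd \<epsilon> 0 * f u" by metis
      then show ?thesis using eps[OF n_pos] by auto
    next
      case False
      then show ?thesis using Zfun_eq_0[OF f] by simp
    qed
  qed
next
  show "unfold (\<lambda>v. f v + g v) = (\<lambda>v. unfold f v + unfold g v)" for f g
    by (rule ext) (simp add: unfold_def algebra_simps sum.distrib)
  show "unfold (\<lambda>v. k * f v) = (\<lambda>v. k * unfold f v)" for k f
    by (rule ext) (simp add: unfold_def algebra_simps sum_distrib_left)
qed (simp_all add: unfold_closed red_lap_unfold)

end

section \<open>DC-tilings are reflective\<close>

lemma tri_inj: "tri s = tri t \<Longrightarrow> s = t"
  using open_tri_nonempty[of s] open_tri_subset[of s] open_tri_tri_disjoint by blast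

lemma compact_tri: "compact (tri t)"
  unfolding tri_def tri_verts_def by (intro compact_convex_hull finite_imp_compact) simp

lemma Aut_M_continuous: "g \<in> Aut_M \<Longrightarrow> continuous_on A g"
  unfolding Aut_M_def by (auto intro: aut_map_continuous)

lemma Aut_M_image_hull: "g \<in> Aut_M \<Longrightarrow> g ` (convex hull A) = convex hull (g ` A)"
  unfolding Aut_M_def using aut_map_image_hull by blast

lemma Aut_M_inj:
  assumes "g \<in> Aut_M"
  shows "inj g"
proof -
  obtain sw s1 s2 t1 t2 where "g = aut_map sw s1 s2 t1 t2" "s1 \<in> {-1, 1}" "s2 \<in> {-1, 1}"
    using assms unfolding Aut_M_def by blast
  then show ?thesis by (metis aut_map_inverse injI)
qed

lemma Aut_M_open_image:
  assumes "g \<in> Aut_M" "open U"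
  shows "open (g ` U)"
proof -
  obtain sw s1 s2 t1 t2 where g: "g = aut_map sw s1 s2 t1 t2" "s1 \<in> {-1, 1}" "s2 \<in> {-1, 1}"
    using assms unfolding Aut_M_def by blast
  obtain g' where g': "continuous_on UNIV g'" "\<And>p. g' (g p) = p" "\<And>p. g (g' p) = p"
    unfolding g(1) by (rule aut_map_inverse[OF g(2,3)]) blast
  have "g ` U = g' -` U"
  proof
    show "g ` U \<subseteq> g' -` U" by (auto simp: g'(2))
    show "g' -` U \<subseteq> g ` U" by (metis g'(3) imageI subsetI vimage_eq)
  qed
  then show ?thesis using g'(1) assms(2) by (simp add: open_vimage)
qed

text \<open>The bounding edges \<open>d\<close> and \<open>d + 1\<close> pull back to
  \<open>c + \<epsilon> * d\<close> and \<open>c + \<epsilon> * (d + 1)\<close>; a sector is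
  numbered by its first edge, which is the latter if \<open>\<epsilon> = -1\<close>. Hence the
  correction by 0 or -1.\<close>

lemma Aut_M_image_sector:
  assumes g: "g \<in> Aut_M" and eps: "\<epsilon> \<in> {-1, 1 :: int}"
    and "\<And>v. g (lattice_pt (\<kappa> v)) = lattice_pt v"
    and "\<And>v d. g (lattice_pt (\<kappa> v) + dvec (c + \<epsilon> * d)) = lattice_pt v + dvec d"
  shows "g ` tri (sector (\<kappa> v) (c + \<epsilon> * d + (\<epsilon> - 1) div 2)) = tri (sector v d)"
proof -
  have "g ` tri_verts (sector (\<kappa> v) (c + \<epsilon> * d + (\<epsilon> - 1) div 2)) = tri_verts (sector v d)"
  proof (cases "\<epsilon> = 1")
    case True
    then show ?thesis
      using assms(3)[of v] assms(4)[of v d] assms(4)[of v "d + 1"]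
      by (simp add: tri_verts_sector add.assoc)
  next
    case False
    then have "\<epsilon> = -1" using eps by simp
    then show ?thesis
      using assms(3)[of v] assms(4)[of v d] assms(4)[of v "d + 1"]
      by (simp add: tri_verts_sector insert_commute algebra_simps)
  qed
  then show ?thesis by (simp add: tri_def Aut_M_image_hull[OF g])
qed

lemma Aut_M_image_tri:
  assumes "g \<in> Aut_M"
  shows "\<exists>t. g ` tri s = tri t"
proof -
  obtain \<kappa> c \<epsilon> where \<kappa>: "\<epsilon> \<in> {-1, 1 :: int}" "even c" "surj \<kappa>"
    "\<And>v. g (lattice_pt (\<kappa> v)) = lattice_pt v"
    "\<And>v d. g (lattice_pt (\<kappa> v) + dvec (c + \<epsilon> * d)) = lattice_pt v + dvec d"
    by (rule Aut_M_action[OF assms]) blast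
  obtain u e where s: "s = sector u e" using sector_surj by blast
  obtain v where u: "u = \<kappa> v" using \<kappa>(3) by (metis surjD)
  have "c + \<epsilon> * (\<epsilon> * (e - c - (\<epsilon> - 1) div 2)) + (\<epsilon> - 1) div 2 = e" using \<kappa>(1) by auto
  then show ?thesis using Aut_M_image_sector[OF assms \<kappa>(1,4,5)] unfolding s u by metis
qed

lemma edge_subset_verts: "e \<in> tri_edges t \<Longrightarrow> e \<subseteq> tri_verts t"
  by (auto simp: tri_edges_def tri_verts_def)

theorem theorem1:
  fixes T1 T2 :: "trid set"
  assumes "convex_polyform T1" and "convex_polyform T2" and "DC_tiles T1 T2"
  shows "\<exists>h. h \<in> hom (sandpile_group (GammaP T1)) (sandpile_group (GammaP T2)) \<and>
             inj_on h (carrier (sandpile_group (GammaP T1)))"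
proof -
  have fin: "finite T1" "finite T2" "T2 \<noteq> {}"
    using assms(1,2) by (simp_all add: convex_polyform_def polyform_def)
  obtain dir col gs where DC: "DC_assignment T1 dir col"
    and Aut: "set gs \<subseteq> Aut_M"
    and disj: "\<forall>i<length gs. \<forall>j<length gs. i \<noteq> j \<longrightarrow>
        (gs ! i) ` region T1 \<inter> (gs ! j) ` region T1 = {}"
    and cover: "(\<Union>i<length gs. closure ((gs ! i) ` region T1)) = closure (region T2)"
    and match: "\<forall>i<length gs. \<forall>j<length gs. \<forall>e\<in>sides T1. \<forall>e'\<in>sides T1.
        i \<noteq> j \<and> (gs ! i) ` e = (gs ! j) ` e' \<longrightarrow>
        col e = col e' \<and> (gs ! i) (dir e) = (gs ! j) (dir e')"
    using assms(3) unfolding DC_tiles_def by (elim exE conjE) (rule that)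
  have dir: "\<And>e. e \<in> sides T1 \<Longrightarrow> dir e \<in> e" and col: "inj_on col (sides T1)"
    using DC by (simp_all add: DC_assignment_def)
  have g: "gs ! i \<in> Aut_M" if "i < length gs" for i using Aut that by auto
  \<comment> \<open>Bundling the data allows one simultaneous choice for all tiles.\<close>
  define P where "P i \<kappa> c \<epsilon> \<longleftrightarrow> \<epsilon> \<in> {-1, 1 :: int} \<and> even c \<and> surj \<kappa> \<and>
      (\<forall>v. (gs ! i) (lattice_pt (\<kappa> v)) = lattice_pt v) \<and>
      (\<forall>v d. (gs ! i) (lattice_pt (\<kappa> v) + dvec (c + \<epsilon> * d)) = lattice_pt v + dvec d)"
    for i \<kappa> c \<epsilon>
  have "\<exists>\<kappa> c \<epsilon>. P i \<kappa> c \<epsilon>" if "i < length gs" for i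
    unfolding P_def by (rule Aut_M_action[OF g[OF that]]) blast
  then obtain \<kappa> c \<epsilon> where P: "P i (\<kappa> i) (c i) (\<epsilon> i)" if "i < length gs" for i by metis
  have act: "\<epsilon> i \<in> {-1, 1}" "even (c i)" "surj (\<kappa> i)"
      "(gs ! i) (lattice_pt (\<kappa> i v)) = lattice_pt v"
      "(gs ! i) (lattice_pt (\<kappa> i v) + dvec (c i + \<epsilon> i * d)) = lattice_pt v + dvec d"
    if "i < length gs" for i v d
    using P[OF that] unfolding P_def by - (elim conjE, (elim allE)?, assumption)+
  define own where "own i t \<longleftrightarrow> (\<exists>s\<in>T1. (gs ! i) ` tri s = tri t)" for i t
  have own_sector: "own i (sector v d) \<longleftrightarrow>
      sector (\<kappa> i v) (c i + \<epsilon> i * d + (\<epsilon> i - 1) div 2) \<in> T1" if i: "i < length gs" for i v d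
  proof -
    have "(gs ! i) ` tri s = tri (sector v d) \<longleftrightarrow>
        s = sector (\<kappa> i v) (c i + \<epsilon> i * d + (\<epsilon> i - 1) div 2)" (is "_ \<longleftrightarrow> s = ?s'") for s
    proof -
      have "(gs ! i) ` tri ?s' = tri (sector v d)"
        by (rule Aut_M_image_sector[OF g[OF i] act(1,4,5)[OF i]])
      then have "(gs ! i) ` tri s = tri (sector v d) \<longleftrightarrow> tri s = tri ?s'"
        using inj_image_eq_iff[OF Aut_M_inj[OF g[OF i]]] by metis
      then show ?thesis using tri_inj by blast
    qed
    then show ?thesis by (simp add: own_def)
  qed
  have own_closure: "tri t \<subseteq> closure ((gs ! i) ` region T1)" if i: "i < length gs" and own: "own i t" for i t
  proof -
    obtain s where s: "s \<in> T1" "(gs ! i) ` tri s = tri t" using own unfolding own_def by blast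
    have "(gs ! i) ` closure (region T1) \<subseteq> closure ((gs ! i) ` region T1)"
      by (intro image_closure_subset Aut_M_continuous g i closed_closure closure_subset)
    then show ?thesis using s tri_subset_region_closure[OF fin(1) s(1)] by blast
  qed
  have open_image: "open ((gs ! i) ` region T1)" if "i < length gs" for i
    by (intro Aut_M_open_image g that open_region)
  \<comment> \<open>An open set disjoint from another set also misses its closure.\<close>
  have disj_closure: "(gs ! i) ` region T1 \<inter> closure ((gs ! j) ` region T1) = {}"
    if "i < length gs" "j < length gs" "i \<noteq> j" for i j
    using disj that open_Int_closure_eq_empty[OF open_image[OF that(1)]] by simp
  \<comment> \<open>Points of a shared edge lie in the closed prototile but not in its open region,
    since their images lie in another closed tile.\<close>
  have side: "e \<in> sides T1"
    if ij: "i < length gs" "j < length gs" "i \<noteq> j" and s: "s \<in> T1" "e \<in> tri_edges s"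
      and t: "own j t" "(gs ! i) ` e \<in> tri_edges t" for i j s t e
  proof -
    have "z \<in> frontier (region T1)" if z: "z \<in> convex hull e" for z
    proof -
      have "z \<in> tri s" using z hull_mono[OF edge_subset_verts[OF s(2)]] unfolding tri_def by blast
      then have "z \<in> closure (region T1)" using tri_subset_region_closure[OF fin(1) s(1)] by blast
      moreover have "(gs ! i) z \<in> convex hull ((gs ! i) ` e)"
        using z Aut_M_image_hull[OF g[OF ij(1)], of e] by blast
      then have "(gs ! i) z \<in> tri t"
        using hull_mono[OF edge_subset_verts[OF t(2)]] unfolding tri_def by blast
      then have "z \<notin> region T1"
        using own_closure[OF ij(2) t(1)] disj_closure[OF ij] by blast
      ultimately show ?thesis by (simp add: frontier_def interior_open open_region)
    qed
    then show ?thesis unfolding sides_def using s by blast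
  qed
  interpret folded_tiling T1 T2 "length gs" \<kappa> c \<epsilon> own
  proof
    show "finite T1" "finite T2" by (fact fin)+
    show "0 < length gs"
    proof (rule ccontr)
      assume "\<not> 0 < length gs"
      then have "closure (region T2) = {}" using cover by simp
      then show False using region_nonempty[OF fin(2,3)] by simp
    qed
  next
    fix i v d assume i: "i < length gs" and d: "even (d :: int)"
    have "even (c i + \<epsilon> i * d)" using act(2)[OF i] d by simp
    then have "(gs ! i) (lattice_pt (\<kappa> i (v + ivec d))) = (gs ! i) (lattice_pt (\<kappa> i v + ivec (c i + \<epsilon> i * d)))"
      using act(4)[OF i, of "v + ivec d"] act(5)[OF i, of v d] d by (simp add: lattice_pt_add dvec_even)
    from injD[OF Aut_M_inj[OF g[OF i]] this]
    show "\<kappa> i (v + ivec d) = \<kappa> i v + ivec (c i + \<epsilon> i * d)" by (rule lattice_pt_inj)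
  next
    fix t
    \<comment> \<open>An inner point identifies \<open>t\<close> among all triangles, so covering by
      point sets becomes covering by triangles.\<close>
    obtain z where z: "z \<in> open_tri t" using open_tri_nonempty[of t] by blast
    then have z': "z \<in> tri t" using open_tri_subset by blast
    show "t \<in> T2 \<longleftrightarrow> (\<exists>i<length gs. own i t)"
    proof
      assume "t \<in> T2"
      then have "z \<in> closure (region T2)" using z' tri_subset_region_closure[OF fin(2)] by blast
      then obtain i where i: "i < length gs" "z \<in> closure ((gs ! i) ` region T1)"
        unfolding cover[symmetric] by blast
      \<comment> \<open>Compactness makes the image of the closed prototile closed, so it contains
        the closed tile.\<close>
      have "compact (closure (region T1))"
        unfolding closure_region[OF fin(1)] using fin(1) by (intro compact_UN compact_tri) auto
      then have "closed ((gs ! i) ` closure (region T1))"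
        by (intro compact_imp_closed compact_continuous_image Aut_M_continuous g i(1))
      then have "closure ((gs ! i) ` region T1) \<subseteq> (gs ! i) ` closure (region T1)"
        by (intro closure_minimal image_mono closure_subset)
      then obtain s where s: "s \<in> T1" "z \<in> (gs ! i) ` tri s"
        using i(2) unfolding closure_region[OF fin(1)] by blast
      obtain t' where t': "(gs ! i) ` tri s = tri t'" using Aut_M_image_tri[OF g[OF i(1)]] by blast
      then have "t' = t" using open_tri_tri_disjoint[OF z] s(2) by simp
      then show "\<exists>i<length gs. own i t" using i(1) s(1) t' unfolding own_def by blast
    next
      assume "\<exists>i<length gs. own i t"
      then obtain i where i: "i < length gs" "own i t" by blast
      then have "z \<in> closure (region T2)"
        using own_closure[OF i] z' cover by blast
      then show "t \<in> T2" using open_tri_meets_tri[OF z] unfolding closure_region[OF fin(2)] by blast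
    qed
  next
    fix i j t assume ij: "i < length gs" "j < length gs" and own: "own i t" "own j t"
    show "i = j"
    proof (rule ccontr)
      assume neq: "i \<noteq> j"
      obtain z where z: "z \<in> open_tri t" using open_tri_nonempty[of t] by blast
      then have "z \<in> closure ((gs ! i) ` region T1)"
        using own_closure[OF ij(1) own(1)] open_tri_subset by blast
      then have "open_tri t \<inter> (gs ! i) ` region T1 \<noteq> {}"
        using z open_Int_closure_eq_empty[OF open_open_tri[of t]] by blast
      then show False
        using own_closure[OF ij(2) own(2)] open_tri_subset disj_closure[OF ij neq] by blast
    qed
  next
    fix i j v d
    assume ij: "i < length gs" "j < length gs" "i \<noteq> j"
      and own: "own i (sector v (d - 1))" "own j (sector v d)"
    \<comment> \<open>The edge of the prototile that tile \<open>k\<close> carries onto the common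
      edge \<open>?E\<close>.\<close>
    let ?e = "\<lambda>k. {lattice_pt (\<kappa> k v), lattice_pt (\<kappa> k v) + dvec (c k + \<epsilon> k * d)}"
    let ?E = "{lattice_pt v, lattice_pt v + dvec d}"
    have img: "(gs ! k) ` ?e k = ?E" if "k < length gs" for k
      using act(4,5)[OF that] by simp
    have E: "?E \<in> tri_edges (sector v (d - 1))" "?E \<in> tri_edges (sector v d)"
      by (simp_all add: tri_edges_sector)
    have edge: "?e k \<in> tri_edges (sector (\<kappa> k v) (c k + \<epsilon> k * d + (\<epsilon> k - 1) div 2))"
      "?e k \<in> tri_edges (sector (\<kappa> k v) (c k + \<epsilon> k * (d - 1) + (\<epsilon> k - 1) div 2))" if "k < length gs" for k
      using act(1)[OF that] by (auto simp: tri_edges_sector algebra_simps)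
    have sides: "?e i \<in> sides T1" "?e j \<in> sides T1"
      using side[OF ij own_sector[OF ij(1), THEN iffD1, OF own(1)] edge(2)[OF ij(1)] own(2)]
        side[OF ij(2,1) ij(3)[symmetric] own_sector[OF ij(2), THEN iffD1, OF own(2)] edge(1)[OF ij(2)] own(1)]
        img ij E by simp_all
    have "col (?e i) = col (?e j)" and dir_eq: "(gs ! i) (dir (?e i)) = (gs ! j) (dir (?e j))"
      using match[rule_format, OF ij(1,2) sides] img ij by simp_all
    \<comment> \<open>Distinct sides have distinct colours, so both tiles use the same side of the
      prototile.\<close>
    then have e_eq: "?e i = ?e j" using col sides by (simp only: inj_on_eq_iff)
    have inj: "inj (gs ! j)" by (intro Aut_M_inj g ij)
    have ends: "lattice_pt (\<kappa> i v) = lattice_pt (\<kappa> j v)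
        \<and> lattice_pt (\<kappa> i v) + dvec (c i + \<epsilon> i * d) = lattice_pt (\<kappa> j v) + dvec (c j + \<epsilon> j * d)"
    \<comment> \<open>The marked endpoint has the same image in both tiles, which rules out an
      identification that exchanges the ends.\<close>
    proof (cases "dir (?e i) = lattice_pt (\<kappa> i v)")
      case True
      then have "(gs ! j) (lattice_pt (\<kappa> i v)) = (gs ! j) (lattice_pt (\<kappa> j v))"
        using dir_eq e_eq act(4) ij by simp
      then have "lattice_pt (\<kappa> i v) = lattice_pt (\<kappa> j v)" by (rule injD[OF inj])
      then show ?thesis using e_eq by (auto simp: doubleton_eq_iff)
    next
      case False
      then have "dir (?e i) = lattice_pt (\<kappa> i v) + dvec (c i + \<epsilon> i * d)"
        using dir[OF sides(1)] by blast
      then have "(gs ! j) (lattice_pt (\<kappa> i v) + dvec (c i + \<epsilon> i * d))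
          = (gs ! j) (lattice_pt (\<kappa> j v) + dvec (c j + \<epsilon> j * d))"
        using dir_eq e_eq act(5) ij by simp
      then have "lattice_pt (\<kappa> i v) + dvec (c i + \<epsilon> i * d) = lattice_pt (\<kappa> j v) + dvec (c j + \<epsilon> j * d)"
        by (rule injD[OF inj])
      then show ?thesis using e_eq by (auto simp: doubleton_eq_iff)
    qed
    then have "\<kappa> i v = \<kappa> j v" using lattice_pt_inj by blast
    moreover have "dvec (c i + \<epsilon> i * d) = dvec (c j + \<epsilon> j * d)"
      using conjunct2[OF ends] unfolding conjunct1[OF ends] by (rule add_left_imp_eq)
    ultimately show "\<kappa> i v = \<kappa> j v \<and> (c i + \<epsilon> i * d) mod 8 = (c j + \<epsilon> j * d) mod 8"
      using dvec_inj by blast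
  qed (use act own_sector in auto)
  show ?thesis by (rule sandpile_monomorphism_exists)
qed

end
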